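(* Let $U\subset\mathbb{R}^2$ be open with coordinates $(x,z)$ and let $\phi:U\to\mathbb{C}$ be a smooth solution of the nonlinear Schrödinger equation $$i\phi_z=-\phi_{xx}-2|\phi|^2\phi .$$ On $U\times\mathbb{C}$, with $\xi$ the complex coordinate on $\mathbb{C}\subset\mathbb{CP}^1$, define the real vector fields $$W=\partial_x+(\bar\phi\,\xi^2+\phi)\partial_\xi+(\phi\,\bar\xi^2+\bar\phi)\partial_{\bar\xi},\qquad \tilde W=\partial_x,\qquad \tilde Z=i\xi\,\partial_\xi-i\bar\xi\,\partial_{\bar\xi},$$ $$Z=\partial_z+i(-\bar\phi_x\xi^2+2|\phi|^2\xi+\phi_x)\partial_\xi-i(-\phi_x\bar\xi^2+2|\phi|^2\bar\xi+\bar\phi_x)\partial_{\bar\xi},$$ and the volume form $$\nu=dx\wedge dz\wedge\frac{i\,d\xi\wedge d\bar\xi}{(1+\xi\bar\xi)^2}.$$ Then $$f^2:=\nu(W,\tilde W,Z,\tilde Z)=\frac{2\,\mathrm{Re}(\bar\xi\phi)}{1+|\xi|^2},$$ and on the open set where $f^2\neq0$ the metric $$g=f^2\,(e_W\odot e_{\tilde W}-e_Z\odot e_{\tilde Z}),$$ where $e_W,e_{\tilde W},e_Z,e_{\tilde Z}$ is the coframe dual to $W,\tilde W,Z,\tilde Z$, is half-flat (Ricci-flat with self-dual Weyl tensor).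
   Context: $\odot$ is the symmetrised tensor product of one-forms (its overall constant normalisation is irrelevant). The symbol $f^2$ denotes the function $\nu(W,\tilde W,Z,\tilde Z)$, which may be negative. "Half-flat" means: the Ricci tensor of $g$ vanishes and the Weyl tensor of $g$ is self-dual, where the orientation is the one for which the two-forms $f^2 e_W\wedge e_Z$, $f^2(e_W\wedge e_{\tilde W}-e_Z\wedge e_{\tilde Z})$ and $f^2 e_{\tilde W}\wedge e_{\tilde Z}$ are anti-self-dual. The metric $g$ has signature $(2,2)$. *)

theory Defs
  imports "HOL-Analysis.Analysis"
begin

definition dderiv :: "('a::real_normed_vector \<Rightarrow> 'b::real_normed_vector) \<Rightarrow> 'a \<Rightarrow> 'a \<Rightarrow> 'b" where
  "dderiv f v p = frechet_derivative f (at p) v"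

text \<open>Meant for open \<open>S\<close> only, as the derivatives are two-sided.\<close>

primrec Ck_on :: "nat \<Rightarrow> 'a::real_normed_vector set \<Rightarrow> ('a \<Rightarrow> 'b::real_normed_vector) \<Rightarrow> bool" where
  "Ck_on 0 S f \<longleftrightarrow> continuous_on S f"
| "Ck_on (Suc k) S f \<longleftrightarrow>
     (\<forall>p\<in>S. f differentiable (at p)) \<and> (\<forall>v. Ck_on k S (dderiv f v))"

definition smooth_on :: "'a::real_normed_vector set \<Rightarrow> ('a \<Rightarrow> 'b::real_normed_vector) \<Rightarrow> bool" where
  "smooth_on S f \<longleftrightarrow> (\<forall>k. Ck_on k S f)"

text \<open>
  Metrics live on an open subset of a Euclidean space. A metric is a function \<open>g\<close> with \<open>g p u v\<close> the inner product of the tangent vectors \<open>u\<close>, \<open>v\<close> at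
  the point \<open>p\<close>. Tangent vectors are identified with constant vector fields, so that
  \<open>christoffel g p u v\<close> is the value at \<open>p\<close> of the Levi-Civita derivative of \<open>v\<close> along \<open>u\<close>, and
  sums over \<open>Basis\<close> are contractions over the coordinate frame.
\<close>

type_synonym 'a metric = "'a \<Rightarrow> 'a \<Rightarrow> 'a \<Rightarrow> real"

definition sharp :: "'a::euclidean_space metric \<Rightarrow> 'a \<Rightarrow> ('a \<Rightarrow> real) \<Rightarrow> 'a" where
  "sharp g p \<alpha> = (THE v. \<forall>w. g p v w = \<alpha> w)"

definition christoffel :: "'a::euclidean_space metric \<Rightarrow> 'a \<Rightarrow> 'a \<Rightarrow> 'a \<Rightarrow> 'a" where
  "christoffel g p u v = sharp g p (\<lambda>w.
     (dderiv (\<lambda>q. g q v w) u p + dderiv (\<lambda>q. g q u w) v p - dderiv (\<lambda>q. g q u v) w p) / 2)"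

text \<open>\<open>R(u,v)w = \<nabla>\<^sub>u \<nabla>\<^sub>v w - \<nabla>\<^sub>v \<nabla>\<^sub>u w\<close> for constant \<open>u\<close>, \<open>v\<close>, \<open>w\<close>.\<close>

definition riemann :: "'a::euclidean_space metric \<Rightarrow> 'a \<Rightarrow> 'a \<Rightarrow> 'a \<Rightarrow> 'a \<Rightarrow> 'a" where
  "riemann g p u v w =
     dderiv (\<lambda>q. christoffel g q v w) u p + christoffel g p u (christoffel g p v w)
   - dderiv (\<lambda>q. christoffel g q u w) v p - christoffel g p v (christoffel g p u w)"

definition ricci :: "'a::euclidean_space metric \<Rightarrow> 'a \<Rightarrow> 'a \<Rightarrow> 'a \<Rightarrow> real" where
  "ricci g p v w = (\<Sum>b\<in>Basis. riemann g p b v w \<bullet> b)"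

text \<open>The inverse metric applied to the coordinate one-form of the basis vector \<open>b\<close>.\<close>

definition raise :: "'a::euclidean_space metric \<Rightarrow> 'a \<Rightarrow> 'a \<Rightarrow> 'a" where
  "raise g p b = sharp g p (\<lambda>w. w \<bullet> b)"

definition scalar_curv :: "'a::euclidean_space metric \<Rightarrow> 'a \<Rightarrow> real" where
  "scalar_curv g p = (\<Sum>b\<in>Basis. ricci g p b (raise g p b))"

definition weyl :: "'a::euclidean_space metric \<Rightarrow> 'a \<Rightarrow> 'a \<Rightarrow> 'a \<Rightarrow> 'a \<Rightarrow> 'a \<Rightarrow> real" where
  "weyl g p u v w t =
     g p (riemann g p u v w) t
   - (ricci g p v w * g p u t - ricci g p u w * g p v t
      + g p v w * ricci g p u t - g p u w * ricci g p v t) / (real DIM('a) - 2)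
   + scalar_curv g p * (g p v w * g p u t - g p u w * g p v t)
      / ((real DIM('a) - 1) * (real DIM('a) - 2))"

text \<open>
  Points are triples \<open>(x, z, \<xi>)\<close>. The tangent vector \<open>(a, b, c)\<close> stands for the real vector
  \<open>a \<partial>\<^sub>x + b \<partial>\<^sub>z + c \<partial>\<^sub>\<xi> + cnj c \<partial>\<^sub>\<xi>\<^sub>b\<^sub>a\<^sub>r\<close>; this is the identification under which \<open>d\<xi>\<close> takes the
  value \<open>c\<close> on it.
\<close>

type_synonym pt = "real \<times> real \<times> complex"

definition dx :: "pt \<Rightarrow> real" where "dx v = fst v"
definition dz :: "pt \<Rightarrow> real" where "dz v = fst (snd v)"
definition dxi :: "pt \<Rightarrow> complex" where "dxi v = snd (snd v)"

definition wedge2 :: "('a \<Rightarrow> 'k::comm_ring_1) \<Rightarrow> ('a \<Rightarrow> 'k) \<Rightarrow> 'a \<Rightarrow> 'a \<Rightarrow> 'k" where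
  "wedge2 \<alpha> \<beta> u v = \<alpha> u * \<beta> v - \<alpha> v * \<beta> u"

definition wedge4 ::
  "('a \<Rightarrow> 'k::comm_ring_1) \<Rightarrow> ('a \<Rightarrow> 'k) \<Rightarrow> ('a \<Rightarrow> 'k) \<Rightarrow> ('a \<Rightarrow> 'k) \<Rightarrow> 'a \<Rightarrow> 'a \<Rightarrow> 'a \<Rightarrow> 'a \<Rightarrow> 'k" where
  "wedge4 \<alpha> \<beta> \<gamma> \<delta> u v w t = det (vector
     [vector [\<alpha> u, \<alpha> v, \<alpha> w, \<alpha> t],
      vector [\<beta> u, \<beta> v, \<beta> w, \<beta> t],
      vector [\<gamma> u, \<gamma> v, \<gamma> w, \<gamma> t],
      vector [\<delta> u, \<delta> v, \<delta> w, \<delta> t]] :: 'k^4^4)"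

definition sym_prod :: "('a \<Rightarrow> real) \<Rightarrow> ('a \<Rightarrow> real) \<Rightarrow> 'a \<Rightarrow> 'a \<Rightarrow> real" where
  "sym_prod \<alpha> \<beta> u v = (\<alpha> u * \<beta> v + \<beta> u * \<alpha> v) / 2"

definition pseudo_metric_22_on :: "pt set \<Rightarrow> pt metric \<Rightarrow> bool" where
  "pseudo_metric_22_on M g \<longleftrightarrow>
     (\<forall>u v. smooth_on M (\<lambda>p. g p u v)) \<and>
     (\<forall>p\<in>M. bilinear (g p) \<and> (\<forall>u v. g p u v = g p v u) \<and>
        (\<exists>b :: pt^4. \<forall>i j. g p (b $ i) (b $ j) =
           (if i \<noteq> j then 0 else if i = 1 \<or> i = 2 then 1 else - 1)))"

text \<open>
  An orientation is encoded by its sign relative to \<open>dx \<and> dz \<and> d(Re \<xi>) \<and> d(Im \<xi>)\<close>.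
\<close>

definition orientation_on :: "pt set \<Rightarrow> (pt \<Rightarrow> real) \<Rightarrow> bool" where
  "orientation_on M s \<longleftrightarrow> continuous_on M s \<and> (\<forall>p\<in>M. s p = 1 \<or> s p = - 1)"

definition coord_frame :: "pt^4" where
  "coord_frame = vector [(1, 0, 0), (0, 1, 0), (0, 0, 1), (0, 0, \<i>)]"

definition vol_form :: "pt metric \<Rightarrow> (pt \<Rightarrow> real) \<Rightarrow> pt \<Rightarrow> pt \<Rightarrow> pt \<Rightarrow> pt \<Rightarrow> pt \<Rightarrow> real" where
  "vol_form g s p u v w t =
     s p * sqrt \<bar>det (\<chi> i j. g p (coord_frame $ i) (coord_frame $ j))\<bar>
     * wedge4 dx dz (\<lambda>y. Re (dxi y)) (\<lambda>y. Im (dxi y)) u v w t"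

definition hodge :: "pt metric \<Rightarrow> (pt \<Rightarrow> real) \<Rightarrow> pt \<Rightarrow> (pt \<Rightarrow> pt \<Rightarrow> real) \<Rightarrow> pt \<Rightarrow> pt \<Rightarrow> real" where
  "hodge g s p \<omega> u v =
     (\<Sum>a\<in>Basis. \<Sum>b\<in>Basis. \<omega> (raise g p a) (raise g p b) * vol_form g s p a b u v) / 2"

definition anti_self_dual :: "pt metric \<Rightarrow> (pt \<Rightarrow> real) \<Rightarrow> pt \<Rightarrow> (pt \<Rightarrow> pt \<Rightarrow> real) \<Rightarrow> bool" where
  "anti_self_dual g s p \<omega> \<longleftrightarrow> (\<forall>u v. hodge g s p \<omega> u v = - \<omega> u v)"

definition self_dual :: "pt metric \<Rightarrow> (pt \<Rightarrow> real) \<Rightarrow> pt \<Rightarrow> (pt \<Rightarrow> pt \<Rightarrow> real) \<Rightarrow> bool" where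
  "self_dual g s p \<omega> \<longleftrightarrow> (\<forall>u v. hodge g s p \<omega> u v = \<omega> u v)"

definition half_flat_on :: "pt set \<Rightarrow> pt metric \<Rightarrow> (pt \<Rightarrow> real) \<Rightarrow> bool" where
  "half_flat_on M g s \<longleftrightarrow>
     (\<forall>p\<in>M. (\<forall>u v. ricci g p u v = 0) \<and>
             (\<forall>w t. self_dual g s p (\<lambda>u v. weyl g p u v w t)))"

definition D_x :: "(real \<times> real \<Rightarrow> complex) \<Rightarrow> real \<times> real \<Rightarrow> complex" where
  "D_x \<phi> = dderiv \<phi> (1, 0)"

definition D_z :: "(real \<times> real \<Rightarrow> complex) \<Rightarrow> real \<times> real \<Rightarrow> complex" where
  "D_z \<phi> = dderiv \<phi> (0, 1)"

definition NLS_on :: "(real \<times> real) set \<Rightarrow> (real \<times> real \<Rightarrow> complex) \<Rightarrow> bool" where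
  "NLS_on U \<phi> \<longleftrightarrow>
     (\<forall>q\<in>U. \<i> * D_z \<phi> q = - D_x (D_x \<phi>) q - 2 * of_real ((cmod (\<phi> q))\<^sup>2) * \<phi> q)"

context
  fixes \<phi> :: "real \<times> real \<Rightarrow> complex"
begin

fun W :: "pt \<Rightarrow> pt" where
  "W (x, z, \<xi>) = (1, 0, cnj (\<phi> (x, z)) * \<xi>\<^sup>2 + \<phi> (x, z))"

fun Wt :: "pt \<Rightarrow> pt" where
  "Wt (x, z, \<xi>) = (1, 0, 0)"

fun Z :: "pt \<Rightarrow> pt" where
  "Z (x, z, \<xi>) =
     (0, 1, \<i> * (- cnj (D_x \<phi> (x, z)) * \<xi>\<^sup>2 + 2 * of_real ((cmod (\<phi> (x, z)))\<^sup>2) * \<xi> + D_x \<phi> (x, z)))"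

fun Zt :: "pt \<Rightarrow> pt" where
  "Zt (x, z, \<xi>) = (0, 0, \<i> * \<xi>)"

definition nu :: "pt \<Rightarrow> pt \<Rightarrow> pt \<Rightarrow> pt \<Rightarrow> pt \<Rightarrow> complex" where
  "nu p u v w t =
     \<i> / (1 + dxi p * cnj (dxi p))\<^sup>2
     * wedge4 (\<lambda>y. of_real (dx y)) (\<lambda>y. of_real (dz y)) dxi (\<lambda>y. cnj (dxi y)) u v w t"

text \<open>The form \<open>nu\<close> is real, so \<open>Re\<close> only changes the type.\<close>

definition f2 :: "pt \<Rightarrow> real" where
  "f2 p = Re (nu p (W p) (Wt p) (Z p) (Zt p))"

definition frame :: "pt \<Rightarrow> pt^4" where
  "frame p = vector [W p, Wt p, Z p, Zt p]"

definition coframe :: "pt \<Rightarrow> 4 \<Rightarrow> pt \<Rightarrow> real" where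
  "coframe p i = (THE \<alpha>. linear \<alpha> \<and> (\<forall>j. \<alpha> (frame p $ j) = (if j = i then 1 else 0)))"

definition e_W :: "pt \<Rightarrow> pt \<Rightarrow> real" where "e_W p = coframe p 1"
definition e_Wt :: "pt \<Rightarrow> pt \<Rightarrow> real" where "e_Wt p = coframe p 2"
definition e_Z :: "pt \<Rightarrow> pt \<Rightarrow> real" where "e_Z p = coframe p 3"
definition e_Zt :: "pt \<Rightarrow> pt \<Rightarrow> real" where "e_Zt p = coframe p 4"

definition nls_metric :: "pt metric" where
  "nls_metric p u v =
     f2 p * (sym_prod (e_W p) (e_Wt p) u v - sym_prod (e_Z p) (e_Zt p) u v)"

definition adapted_orientation_on :: "pt set \<Rightarrow> (pt \<Rightarrow> real) \<Rightarrow> bool" where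
  "adapted_orientation_on M s \<longleftrightarrow> orientation_on M s \<and>
     (\<forall>p\<in>M.
        anti_self_dual nls_metric s p (\<lambda>u v. f2 p * wedge2 (e_W p) (e_Z p) u v) \<and>
        anti_self_dual nls_metric s p
          (\<lambda>u v. f2 p * (wedge2 (e_W p) (e_Wt p) u v - wedge2 (e_Z p) (e_Zt p) u v)) \<and>
        anti_self_dual nls_metric s p (\<lambda>u v. f2 p * wedge2 (e_Wt p) (e_Zt p) u v))"

end

end

theory Submission
  imports Defs
begin

text \<open>
  Label the frame by a pair of spinor indices, \<open>V 0 0' = W\<close>, \<open>V 0 1' = Zt\<close>,
  \<open>V 1 0' = Z\<close>, \<open>V 1 1' = Wt\<close>. The Schroedinger equation says exactly that the two vector fields
  \<open>V A 0' + \<lambda> V A 1'\<close> commute for every \<open>\<lambda>\<close>, and all four fields preserve \<open>nu\<close>. Hence a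
  connection of the form \<open>\<nabla> (V B B') = (\<Sum>C. \<Gamma> B C *\<^sub>R V C B')\<close>, whose coefficients are read off
  from the brackets, is torsion free, and divergence freeness is the trace condition that makes it
  metric; so it is the Levi-Civita connection. Its curvature acts on the unprimed index only and is
  trace free there, and the first Bianchi identity then forces it to be totally symmetric in its
  unprimed indices. This leaves neither Ricci curvature nor an anti-self-dual Weyl part.
\<close>

subsection \<open>Directional derivatives and smooth functions\<close>

text \<open>The metric is \<open>h / 2\<close> times the product of the two constant symplectic
  forms \<epsilon>, \<epsilon>' on the unprimed and primed index. The primed basis is parallel, so
  \<epsilon>' costs nothing; the connection scales \<epsilon> by the trace of \<open>conn\<close>,
  and this has to be balanced by the derivative of \<open>h\<close>.

  The notions to be checked are written in coordinates: constant vector fields, sums over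
  \<open>Basis\<close>, and inverse metrics given by \<open>THE\<close>. The argument lives in a
  moving null frame. Therefore \<open>nabla\<close> is set up on constant fields, for which
  vanishing torsion is plain symmetry and the Bianchi identity is a cancellation, and every
  contraction is first carried over to the frame.

  An orientation is known only through the forms that it declares anti-self-dual. On two-forms the
  star acts by a factor \<kappa> on the part antisymmetric in the unprimed index and by -\<kappa> on
  the part symmetric in it. A single form of the first kind forces \<kappa> = -1, which puts the
  curvature, a form of the second kind, on the self-dual side.\<close>

lemma dderiv_eqI: "(f has_derivative f') (at p) \<Longrightarrow> dderiv f v p = f' v"
  by (simp add: dderiv_def frechet_derivative_at[symmetric])

lemma has_derivative_dderiv:
  "f differentiable (at p) \<Longrightarrow> (f has_derivative (\<lambda>v. dderiv f v p)) (at p)"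
  by (simp add: dderiv_def frechet_derivative_works[symmetric])

lemma linear_dderiv: "f differentiable (at p) \<Longrightarrow> linear (\<lambda>v. dderiv f v p)"
  using has_derivative_dderiv has_derivative_linear by blast

text \<open>The choice in \<open>frechet_derivative\<close> ranges over the same predicate on both
  sides, so the equality holds also where neither function is differentiable.\<close>

lemma dderiv_cong_open:
  assumes "open S" "p \<in> S" "\<And>q. q \<in> S \<Longrightarrow> f q = g q"
  shows "dderiv f v p = dderiv g v p"
proof -
  have "(f has_derivative f') (at p) \<longleftrightarrow> (g has_derivative f') (at p)" for f'
    using has_derivative_transform_within_open[OF _ assms(1,2), of f f' UNIV g]
      has_derivative_transform_within_open[OF _ assms(1,2), of g f' UNIV f] assms(3) by auto
  then show ?thesis
    unfolding dderiv_def frechet_derivative_def by simp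
qed

lemma differentiable_cong_open:
  assumes "open S" "p \<in> S" "\<And>q. q \<in> S \<Longrightarrow> f q = g q" "f differentiable (at p)"
  shows "g differentiable (at p)"
proof -
  obtain f' where "(f has_derivative f') (at p)" using assms(4) unfolding differentiable_def by blast
  from has_derivative_transform_within_open[OF this assms(1,2,3)] show ?thesis
    by (rule differentiableI)
qed

lemma Ck_on_cong:
  assumes "open S" "\<And>q. q \<in> S \<Longrightarrow> f q = g q" "Ck_on k S f"
  shows "Ck_on k S g"
  using assms
proof (induction k arbitrary: f g)
  case 0
  then show ?case by (metis Ck_on.simps(1) continuous_on_cong)
next
  case (Suc k)
  have "g differentiable (at p)" if "p \<in> S" for p
    using differentiable_cong_open[OF Suc.prems(1) that Suc.prems(2)] Suc.prems(3) that by simp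
  moreover have "Ck_on k S (dderiv g v)" for v
    using Suc.IH[OF Suc.prems(1), of "dderiv f v" "dderiv g v"]
      dderiv_cong_open[OF Suc.prems(1) _ Suc.prems(2)] Suc.prems(3) by simp
  ultimately show ?case by simp
qed

lemma Ck_on_imp_continuous_on: "Ck_on k S f \<Longrightarrow> continuous_on S f"
proof (cases k)
  case (Suc j)
  assume "Ck_on k S f"
  then have "\<forall>p\<in>S. isCont f p"
    using Suc differentiable_imp_continuous_within by auto
  then show ?thesis by (rule continuous_at_imp_continuous_on)
qed simp

lemma Ck_on_Suc_imp: "Ck_on (Suc k) S f \<Longrightarrow> Ck_on k S f"
proof (induction k arbitrary: f)
  case 0
  then show ?case by (metis Ck_on.simps(1) Ck_on_imp_continuous_on)
next
  case (Suc k)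
  then show ?case by (metis Ck_on.simps(2))
qed

lemma Ck_on_const: "Ck_on k S (\<lambda>_. c)"
proof (induction k arbitrary: c)
  case (Suc k)
  have "dderiv (\<lambda>_::'a. c) v = (\<lambda>_. 0)" for v
    by (auto intro!: ext dderiv_eqI[OF has_derivative_const])
  then show ?case using Suc by simp
qed simp

lemma Ck_on_bounded_linear:
  assumes "bounded_linear f"
  shows "Ck_on k S f"
proof (cases k)
  case 0
  then show ?thesis using assms by (simp add: linear_continuous_on)
next
  case (Suc j)
  have "dderiv f v = (\<lambda>_. f v)" for v
    by (auto intro!: ext dderiv_eqI bounded_linear_imp_has_derivative assms)
  then show ?thesis
    using Suc assms by (simp add: Ck_on_const bounded_linear_imp_differentiable)
qed

lemma Ck_on_add:
  assumes "open S" "Ck_on k S f" "Ck_on k S g"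
  shows "Ck_on k S (\<lambda>p. f p + g p)"
  using assms(2,3)
proof (induction k arbitrary: f g)
  case 0
  then show ?case by (simp add: continuous_on_add)
next
  case (Suc k)
  have d: "((\<lambda>p. f p + g p) has_derivative (\<lambda>v. dderiv f v p + dderiv g v p)) (at p)"
    if "p \<in> S" for p
    using Suc.prems that by (intro has_derivative_add has_derivative_dderiv) auto
  have "Ck_on k S (dderiv (\<lambda>p. f p + g p) v)" for v
  proof (rule Ck_on_cong[OF assms(1)])
    show "Ck_on k S (\<lambda>p. dderiv f v p + dderiv g v p)"
      using Suc.prems by (intro Suc.IH) simp_all
  qed (rule dderiv_eqI[OF d, symmetric])
  then show ?case using d by (auto intro: differentiableI)
qed

text \<open>The product rule leaves \<open>f\<close> and \<open>g\<close> themselves next to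
  derivatives of order \<open>k\<close>; \<open>Ck_on_Suc_imp\<close> lowers their order so that the
  induction hypothesis fits.\<close>

lemma (in bounded_bilinear) Ck_on_prod:
  assumes "open S" "Ck_on k S f" "Ck_on k S g"
  shows "Ck_on k S (\<lambda>p. prod (f p) (g p))"
  using assms(2,3)
proof (induction k arbitrary: f g)
  case 0
  then show ?case by (simp add: continuous_on)
next
  case (Suc k)
  have d: "((\<lambda>p. prod (f p) (g p)) has_derivative
      (\<lambda>v. prod (f p) (dderiv g v p) + prod (dderiv f v p) (g p))) (at p)" if "p \<in> S" for p
    using Suc.prems that by (intro FDERIV has_derivative_dderiv) auto
  have "Ck_on k S (dderiv (\<lambda>p. prod (f p) (g p)) v)" for v
  proof (rule Ck_on_cong[OF assms(1)])
    show "Ck_on k S (\<lambda>p. prod (f p) (dderiv g v p) + prod (dderiv f v p) (g p))"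
      using Suc.prems Ck_on_Suc_imp[OF Suc.prems(1)] Ck_on_Suc_imp[OF Suc.prems(2)]
      by (intro Ck_on_add[OF assms(1)] Suc.IH) simp_all
  qed (rule dderiv_eqI[OF d, symmetric])
  then show ?case using d by (auto intro: differentiableI)
qed

text \<open>As \<open>L\<close> is linear, the direction \<open>L v\<close> does not depend on the
  point. The derivative is again a function composed with \<open>L\<close>, and the induction
  closes.\<close>

lemma Ck_on_comp_linear:
  assumes "bounded_linear L" "open S" "open T" "L ` S \<subseteq> T" "Ck_on k T f"
  shows "Ck_on k S (\<lambda>p. f (L p))"
  using assms(5)
proof (induction k arbitrary: f)
  case 0
  have "continuous_on T f" using 0 by simp
  then have "continuous_on S (\<lambda>p. f (L p))"
    by (rule continuous_on_compose2[OF _ linear_continuous_on[OF assms(1)] assms(4)])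
  then show ?case by simp
next
  case (Suc k)
  have d: "((\<lambda>p. f (L p)) has_derivative (\<lambda>v. dderiv f (L v) (L p))) (at p)" if "p \<in> S" for p
  proof (rule has_derivative_compose[of L L p UNIV f])
    show "(L has_derivative L) (at p)" by (rule bounded_linear_imp_has_derivative[OF assms(1)])
    have "L p \<in> T" using that assms(4) by blast
    then have "f differentiable (at (L p))" using Suc.prems by (simp only: Ck_on.simps)
    then show "(f has_derivative (\<lambda>v. dderiv f v (L p))) (at (L p))"
      by (rule has_derivative_dderiv)
  qed
  have "Ck_on k S (dderiv (\<lambda>p. f (L p)) v)" for v
  proof (rule Ck_on_cong[OF assms(2)])
    have "Ck_on k T (dderiv f (L v))" using Suc.prems by (simp only: Ck_on.simps)
    then show "Ck_on k S (\<lambda>p. dderiv f (L v) (L p))" by (rule Suc.IH)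
    show "\<And>q. q \<in> S \<Longrightarrow> dderiv f (L v) (L q) = dderiv (\<lambda>p. f (L p)) v q"
      by (rule dderiv_eqI[OF d, symmetric])
  qed
  moreover have "(\<lambda>p. f (L p)) differentiable (at p)" if "p \<in> S" for p
    by (rule differentiableI[OF d[OF that]])
  ultimately show ?case unfolding Ck_on.simps by blast
qed

text \<open>The derivative of the inverse contains the inverse again, but only to order
  \<open>k\<close>, where the induction already provides it.\<close>

lemma Ck_on_inverse:
  fixes f :: "'a::real_normed_vector \<Rightarrow> real"
  assumes "open S" "Ck_on k S f" "\<And>p. p \<in> S \<Longrightarrow> f p \<noteq> 0"
  shows "Ck_on k S (\<lambda>p. inverse (f p))"
  using assms(2)
proof (induction k)
  case 0
  then show ?case using assms(3) by (simp add: continuous_on_inverse)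
next
  case (Suc k)
  have d: "((\<lambda>p. inverse (f p)) has_derivative
      (\<lambda>v. (- 1) * (dderiv f v p * (inverse (f p) * inverse (f p))))) (at p)" if "p \<in> S" for p
  proof -
    have "(f has_derivative (\<lambda>v. dderiv f v p)) (at p)"
      using Suc.prems that by (intro has_derivative_dderiv) simp
    from Deriv.has_derivative_inverse[OF assms(3)[OF that] this] show ?thesis
      by (simp add: mult.commute mult.left_commute)
  qed
  have IH: "Ck_on k S (\<lambda>p. inverse (f p))" using Suc.IH Suc.prems Ck_on_Suc_imp by blast
  have "Ck_on k S (\<lambda>p. (- 1) * (dderiv f v p * (inverse (f p) * inverse (f p))))" for v
    using Suc.prems
    by (intro bounded_bilinear.Ck_on_prod[OF bounded_bilinear_mult assms(1)] Ck_on_const IH) simp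
  then have "Ck_on k S (dderiv (\<lambda>p. inverse (f p)) v)" for v
    by (rule Ck_on_cong[OF assms(1), rotated]) (rule dderiv_eqI[OF d, symmetric])
  then show ?case using d by (auto intro: differentiableI)
qed

lemma smooth_on_subset: "smooth_on T f \<Longrightarrow> S \<subseteq> T \<Longrightarrow> smooth_on S f"
proof -
  have "Ck_on k T f \<Longrightarrow> S \<subseteq> T \<Longrightarrow> Ck_on k S f" for k f
    by (induction k arbitrary: f) (auto intro: continuous_on_subset)
  then show "smooth_on T f \<Longrightarrow> S \<subseteq> T \<Longrightarrow> smooth_on S f"
    unfolding smooth_on_def by blast
qed

named_theorems smooth_intros

lemma smooth_on_imp_differentiable: "smooth_on S f \<Longrightarrow> p \<in> S \<Longrightarrow> f differentiable (at p)"
  unfolding smooth_on_def by (metis Ck_on.simps(2))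

lemma smooth_on_imp_continuous_on: "smooth_on S f \<Longrightarrow> continuous_on S f"
  unfolding smooth_on_def by (metis Ck_on.simps(1))

lemma smooth_on_has_derivative:
  "smooth_on S f \<Longrightarrow> p \<in> S \<Longrightarrow> (f has_derivative (\<lambda>v. dderiv f v p)) (at p)"
  by (simp add: has_derivative_dderiv smooth_on_imp_differentiable)

lemma smooth_on_cong:
  "open S \<Longrightarrow> (\<And>q. q \<in> S \<Longrightarrow> f q = g q) \<Longrightarrow> smooth_on S f \<Longrightarrow> smooth_on S g"
  unfolding smooth_on_def using Ck_on_cong by blast

lemma smooth_on_dderiv [smooth_intros]: "smooth_on S f \<Longrightarrow> smooth_on S (dderiv f v)"
  unfolding smooth_on_def by (metis Ck_on.simps(2))

lemma smooth_on_const [smooth_intros]: "smooth_on S (\<lambda>_. c)"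
  by (simp add: smooth_on_def Ck_on_const)

lemma smooth_on_bounded_linear: "bounded_linear f \<Longrightarrow> smooth_on S f"
  by (simp add: smooth_on_def Ck_on_bounded_linear)

lemma smooth_on_add [smooth_intros]:
  "open S \<Longrightarrow> smooth_on S f \<Longrightarrow> smooth_on S g \<Longrightarrow> smooth_on S (\<lambda>p. f p + g p)"
  by (simp add: smooth_on_def Ck_on_add)

lemma smooth_on_bilinear:
  "bounded_bilinear h \<Longrightarrow> open S \<Longrightarrow> smooth_on S f \<Longrightarrow> smooth_on S g \<Longrightarrow>
    smooth_on S (\<lambda>p. h (f p) (g p))"
  by (simp add: smooth_on_def bounded_bilinear.Ck_on_prod)

lemmas smooth_on_mult [smooth_intros] = smooth_on_bilinear[OF bounded_bilinear_mult]
lemmas smooth_on_scaleR [smooth_intros] = smooth_on_bilinear[OF bounded_bilinear_scaleR]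
lemmas smooth_on_inner [smooth_intros] = smooth_on_bilinear[OF bounded_bilinear_inner]

lemma smooth_on_linear_comp:
  assumes "bounded_linear L" "open S" "smooth_on S f"
  shows "smooth_on S (\<lambda>p. L (f p))"
proof -
  \<comment> \<open>A linear map is a bilinear product with the constant 1, so the product rule for
    bilinear maps covers this case.\<close>
  have "bounded_bilinear (\<lambda>(r::real) x. r *\<^sub>R L x)"
    by (rule bounded_bilinear.comp[OF bounded_bilinear_scaleR bounded_linear_ident assms(1)])
  from smooth_on_bilinear[OF this assms(2) smooth_on_const[of S 1] assms(3)] show ?thesis by simp
qed

lemma smooth_on_comp_linear:
  "bounded_linear L \<Longrightarrow> open S \<Longrightarrow> open T \<Longrightarrow> L ` S \<subseteq> T \<Longrightarrow> smooth_on T f \<Longrightarrow>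
    smooth_on S (\<lambda>p. f (L p))"
  unfolding smooth_on_def using Ck_on_comp_linear by blast

lemmas smooth_on_cnj [smooth_intros] = smooth_on_linear_comp[OF bounded_linear_cnj]
lemmas smooth_on_Re [smooth_intros] = smooth_on_linear_comp[OF bounded_linear_Re]
lemmas smooth_on_Im [smooth_intros] = smooth_on_linear_comp[OF bounded_linear_Im]

lemma smooth_on_uminus [smooth_intros]: "open S \<Longrightarrow> smooth_on S f \<Longrightarrow> smooth_on S (\<lambda>p. - f p)"
  by (rule smooth_on_linear_comp[OF bounded_linear_minus[OF bounded_linear_ident]])

lemma smooth_on_diff [smooth_intros]:
  "open S \<Longrightarrow> smooth_on S f \<Longrightarrow> smooth_on S g \<Longrightarrow> smooth_on S (\<lambda>p. f p - g p)"
  using smooth_on_add[of S f "\<lambda>p. - g p"] by (simp add: smooth_on_uminus)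

lemma smooth_on_power [smooth_intros]:
  fixes f :: "'a::real_normed_vector \<Rightarrow> 'b::real_normed_algebra_1"
  shows "open S \<Longrightarrow> smooth_on S f \<Longrightarrow> smooth_on S (\<lambda>p. f p ^ n)"
  by (induction n) (auto intro!: smooth_intros)

lemma smooth_on_sum [smooth_intros]:
  "open S \<Longrightarrow> (\<And>i. i \<in> I \<Longrightarrow> smooth_on S (f i)) \<Longrightarrow> smooth_on S (\<lambda>p. \<Sum>i\<in>I. f i p)"
  by (induction I rule: infinite_finite_induct) (auto intro!: smooth_intros)

lemma smooth_on_inverse [smooth_intros]:
  fixes f :: "'a::real_normed_vector \<Rightarrow> real"
  shows "open S \<Longrightarrow> smooth_on S f \<Longrightarrow> (\<And>p. p \<in> S \<Longrightarrow> f p \<noteq> 0) \<Longrightarrow> smooth_on S (\<lambda>p. inverse (f p))"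
  by (simp add: smooth_on_def Ck_on_inverse)

lemma smooth_on_divide [smooth_intros]:
  fixes f :: "'a::real_normed_vector \<Rightarrow> real"
  shows "open S \<Longrightarrow> smooth_on S f \<Longrightarrow> smooth_on S g \<Longrightarrow> (\<And>p. p \<in> S \<Longrightarrow> g p \<noteq> 0) \<Longrightarrow>
    smooth_on S (\<lambda>p. f p / g p)"
  by (simp add: divide_inverse smooth_on_mult smooth_on_inverse)

lemma smooth_on_Pair [smooth_intros]:
  assumes "open S" "smooth_on S f" "smooth_on S g"
  shows "smooth_on S (\<lambda>p. (f p, g p))"
proof -
  have L: "bounded_linear (\<lambda>x. (x, 0))" "bounded_linear (\<lambda>y. (0, y))"
    by (intro bounded_linear_Pair bounded_linear_ident bounded_linear_zero)+
  have "smooth_on S (\<lambda>p. (f p, 0) + (0, g p))"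
    by (rule smooth_on_add[OF assms(1) smooth_on_linear_comp[OF L(1) assms(1,2)]
          smooth_on_linear_comp[OF L(2) assms(1,3)]])
  then show ?thesis by simp
qed

lemma dderiv_sum_Basis:
  fixes f :: "'a::euclidean_space \<Rightarrow> 'b::real_normed_vector"
  assumes "f differentiable (at p)"
  shows "dderiv f v p = (\<Sum>b\<in>Basis. (v \<bullet> b) *\<^sub>R dderiv f b p)"
proof -
  interpret linear "\<lambda>v. dderiv f v p" by (rule linear_dderiv[OF assms])
  have "dderiv f v p = dderiv f (\<Sum>b\<in>Basis. (v \<bullet> b) *\<^sub>R b) p"
    by (simp add: euclidean_representation)
  then show ?thesis by (simp add: sum scale)
qed

text \<open>\<open>smooth_on\<close> speaks of fixed directions only; a direction varying with the
  point is expanded in \<open>Basis\<close>.\<close>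

lemma smooth_on_dderiv_along [smooth_intros]:
  fixes f :: "'a::euclidean_space \<Rightarrow> 'b::real_normed_vector"
  assumes "open S" "smooth_on S f" "smooth_on S X"
  shows "smooth_on S (\<lambda>p. dderiv f (X p) p)"
proof (rule smooth_on_cong[OF assms(1)])
  show "smooth_on S (\<lambda>p. \<Sum>b\<in>Basis. (X p \<bullet> b) *\<^sub>R dderiv f b p)"
    by (intro smooth_intros assms)
qed (simp add: dderiv_sum_Basis smooth_on_imp_differentiable[OF assms(2)])

subsection \<open>Symmetry of second derivatives\<close>

text \<open>The mean value theorem twice: along \<open>u\<close> for the difference of
  \<open>f\<close> on two opposite sides of the parallelogram, then along \<open>v\<close> for
  \<open>dderiv f u\<close>.\<close>

lemma second_difference_mean_value:
  fixes f :: "'a::real_normed_vector \<Rightarrow> real"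
  assumes "h > 0"
    and in_S: "\<And>s t. 0 \<le> s \<Longrightarrow> s \<le> h \<Longrightarrow> 0 \<le> t \<Longrightarrow> t \<le> h \<Longrightarrow> p + s *\<^sub>R u + t *\<^sub>R v \<in> S"
    and f: "\<And>q. q \<in> S \<Longrightarrow> f differentiable (at q)"
    and Df: "\<And>q. q \<in> S \<Longrightarrow> dderiv f u differentiable (at q)"
  obtains s t where "0 \<le> s" "s \<le> h" "0 \<le> t" "t \<le> h"
    "f (p + h *\<^sub>R u + h *\<^sub>R v) - f (p + h *\<^sub>R u) - f (p + h *\<^sub>R v) + f p
      = h * h * dderiv (dderiv f u) v (p + s *\<^sub>R u + t *\<^sub>R v)"
proof -
  have d: "((\<lambda>s. F (a + s *\<^sub>R w)) has_real_derivative dderiv F w (a + s *\<^sub>R w)) (at s)"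
    if "F differentiable (at (a + s *\<^sub>R w))" for F :: "'a \<Rightarrow> real" and a w s
  proof -
    have "((\<lambda>s. F (a + s *\<^sub>R w)) has_derivative (\<lambda>y. dderiv F (y *\<^sub>R w) (a + s *\<^sub>R w))) (at s)"
      by (rule has_derivative_compose[of "\<lambda>s. a + s *\<^sub>R w" "\<lambda>y. y *\<^sub>R w" s UNIV F])
        (auto intro!: derivative_eq_intros has_derivative_dderiv that)
    moreover have "(\<lambda>y. dderiv F (y *\<^sub>R w) (a + s *\<^sub>R w)) = (*) (dderiv F w (a + s *\<^sub>R w))"
      by (simp add: fun_eq_iff linear_cmul[OF linear_dderiv[OF that]])
    ultimately show ?thesis by (simp add: has_field_derivative_def)
  qed
  have "\<exists>s>0. s < h \<and> (f (p + h *\<^sub>R v + h *\<^sub>R u) - f (p + h *\<^sub>R u))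
      - (f (p + h *\<^sub>R v + 0 *\<^sub>R u) - f (p + 0 *\<^sub>R u))
      = (h - 0) * (dderiv f u (p + h *\<^sub>R v + s *\<^sub>R u) - dderiv f u (p + s *\<^sub>R u))"
  proof (rule MVT2[OF assms(1)])
    fix s assume s: "0 \<le> s" "s \<le> h"
    show "((\<lambda>s. f (p + h *\<^sub>R v + s *\<^sub>R u) - f (p + s *\<^sub>R u)) has_real_derivative
        dderiv f u (p + h *\<^sub>R v + s *\<^sub>R u) - dderiv f u (p + s *\<^sub>R u)) (at s)"
      using in_S[of s h] in_S[of s 0] s assms(1)
      by (intro DERIV_diff d f) (auto simp: algebra_simps)
  qed
  then obtain s where s: "0 < s" "s < h" and
    1: "(f (p + h *\<^sub>R v + h *\<^sub>R u) - f (p + h *\<^sub>R u)) - (f (p + h *\<^sub>R v) - f p)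
      = h * (dderiv f u (p + h *\<^sub>R v + s *\<^sub>R u) - dderiv f u (p + s *\<^sub>R u))"
    by auto
  have "\<exists>t>0. t < h \<and> dderiv f u (p + s *\<^sub>R u + h *\<^sub>R v) - dderiv f u (p + s *\<^sub>R u + 0 *\<^sub>R v)
      = (h - 0) * dderiv (dderiv f u) v (p + s *\<^sub>R u + t *\<^sub>R v)"
    using in_S s by (intro MVT2[OF assms(1)] d Df) auto
  then obtain t where "0 < t" "t < h" and
    "dderiv f u (p + s *\<^sub>R u + h *\<^sub>R v) - dderiv f u (p + s *\<^sub>R u)
      = h * dderiv (dderiv f u) v (p + s *\<^sub>R u + t *\<^sub>R v)"
    by auto
  with s 1 show ?thesis
    by (intro that[of s t]) (auto simp: algebra_simps)
qed

text \<open>The second difference is symmetric in \<open>u\<close> and \<open>v\<close>, so the two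
  mixed derivatives take a common value at two points close to \<open>p\<close>. By continuity they
  cannot differ at \<open>p\<close>.\<close>

lemma dderiv_commute:
  fixes f :: "'a::real_normed_vector \<Rightarrow> real"
  assumes "open S" "p \<in> S" "smooth_on S f"
  shows "dderiv (dderiv f u) v p = dderiv (dderiv f v) u p"
proof (rule ccontr)
  define A where "A = dderiv (dderiv f u) v"
  define B where "B = dderiv (dderiv f v) u"
  assume "dderiv (dderiv f u) v p \<noteq> dderiv (dderiv f v) u p"
  then have e: "dist (A p) (B p) > 0" by (simp add: A_def B_def)
  have sm: "smooth_on S A" "smooth_on S B" "smooth_on S (dderiv f u)" "smooth_on S (dderiv f v)"
    unfolding A_def B_def by (intro smooth_intros assms)+
  have "isCont A p" "isCont B p"
    using sm assms by (meson differentiable_imp_continuous_within smooth_on_imp_differentiable)+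
  then have "\<exists>d>0. \<forall>q. dist q p < d \<longrightarrow> dist (A q) (A p) < dist (A p) (B p) / 2"
    "\<exists>d>0. \<forall>q. dist q p < d \<longrightarrow> dist (B q) (B p) < dist (A p) (B p) / 2"
    using half_gt_zero[OF e] unfolding continuous_at_eps_delta by blast+
  then obtain d1 d2 where d: "d1 > 0" "d2 > 0"
    "\<And>q. dist q p < d1 \<Longrightarrow> dist (A q) (A p) < dist (A p) (B p) / 2"
    "\<And>q. dist q p < d2 \<Longrightarrow> dist (B q) (B p) < dist (A p) (B p) / 2"
    by blast
  obtain d3 where d3: "d3 > 0" "ball p d3 \<subseteq> S" using assms openE by blast
  \<comment> \<open>With this size the whole parallelogram lies within all three radii around
    \<open>p\<close>; the summand 1 keeps the denominator positive when \<open>u\<close> and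
    \<open>v\<close> vanish.\<close>
  define h where "h = min d1 (min d2 d3) / (2 * (norm u + norm v + 1))"
  have h: "h > 0" unfolding h_def using d d3
    by (intro divide_pos_pos) (auto intro: add_nonneg_pos)
  have hn: "h * (norm u + norm v) < min d1 (min d2 d3)"
  proof -
    have "norm u + norm v + 1 > 0" by (simp add: add_nonneg_pos)
    then have "h * (norm u + norm v + 1) = min d1 (min d2 d3) / 2"
      unfolding h_def by (simp add: field_simps)
    then have "h * (norm u + norm v) = min d1 (min d2 d3) / 2 - h" by (simp add: algebra_simps)
    moreover have "min d1 (min d2 d3) > 0" using d(1,2) d3(1) by simp
    ultimately show ?thesis using h by linarith
  qed
  have near: "dist (p + s *\<^sub>R a + t *\<^sub>R b) p < min d1 (min d2 d3)"
    if "0 \<le> s" "s \<le> h" "0 \<le> t" "t \<le> h" "(a, b) = (u, v) \<or> (a, b) = (v, u)" for s t a b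
  proof -
    have "dist (p + s *\<^sub>R a + t *\<^sub>R b) p \<le> norm (s *\<^sub>R a) + norm (t *\<^sub>R b)"
      using norm_triangle_ineq[of "s *\<^sub>R a" "t *\<^sub>R b"] by (simp add: dist_norm add.assoc)
    also have "\<dots> \<le> h * norm a + h * norm b"
      using that by (auto intro!: add_mono mult_right_mono)
    also have "\<dots> = h * (norm u + norm v)" using that(5) by (auto simp: algebra_simps)
    finally show ?thesis using hn by linarith
  qed
  then have in_S: "p + s *\<^sub>R a + t *\<^sub>R b \<in> S"
    if "0 \<le> s" "s \<le> h" "0 \<le> t" "t \<le> h" "(a, b) = (u, v) \<or> (a, b) = (v, u)" for s t a b
    using near[OF that] d3(2) by (auto simp: dist_commute subset_iff)
  obtain s t where st: "0 \<le> s" "s \<le> h" "0 \<le> t" "t \<le> h"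
    "f (p + h *\<^sub>R u + h *\<^sub>R v) - f (p + h *\<^sub>R u) - f (p + h *\<^sub>R v) + f p
      = h * h * A (p + s *\<^sub>R u + t *\<^sub>R v)"
    unfolding A_def
    by (rule second_difference_mean_value[of h p u v S f])
      (use in_S h assms(3) sm smooth_on_imp_differentiable in auto)
  obtain s' t' where st': "0 \<le> s'" "s' \<le> h" "0 \<le> t'" "t' \<le> h"
    "f (p + h *\<^sub>R v + h *\<^sub>R u) - f (p + h *\<^sub>R v) - f (p + h *\<^sub>R u) + f p
      = h * h * B (p + s' *\<^sub>R v + t' *\<^sub>R u)"
    unfolding B_def
    by (rule second_difference_mean_value[of h p v u S f])
      (use in_S h assms(3) sm smooth_on_imp_differentiable in auto)
  have "h * h * A (p + s *\<^sub>R u + t *\<^sub>R v) = h * h * B (p + s' *\<^sub>R v + t' *\<^sub>R u)"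
    using st(5) st'(5) by (simp add: algebra_simps)
  then have "A (p + s *\<^sub>R u + t *\<^sub>R v) = B (p + s' *\<^sub>R v + t' *\<^sub>R u)" using h by simp
  moreover have "dist (A (p + s *\<^sub>R u + t *\<^sub>R v)) (A p) < dist (A p) (B p) / 2"
    using near[OF st(1-4)] by (intro d) auto
  moreover have "dist (B (p + s' *\<^sub>R v + t' *\<^sub>R u)) (B p) < dist (A p) (B p) / 2"
    using near[OF st'(1-4)] by (intro d) auto
  ultimately show False
    by (metis dist_commute dist_triangle_half_l less_irrefl)
qed

subsection \<open>Half-flatness from a Lax pair of vector fields\<close>

lemma dderiv_add:
  "f differentiable (at p) \<Longrightarrow> g differentiable (at p) \<Longrightarrow>
    dderiv (\<lambda>q. f q + g q) v p = dderiv f v p + dderiv g v p"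
  by (rule dderiv_eqI[OF has_derivative_add[OF has_derivative_dderiv has_derivative_dderiv]])

lemma dderiv_mult:
  fixes f g :: "'a::real_normed_vector \<Rightarrow> 'b::real_normed_algebra"
  shows "f differentiable (at p) \<Longrightarrow> g differentiable (at p) \<Longrightarrow>
    dderiv (\<lambda>q. f q * g q) v p = f p * dderiv g v p + dderiv f v p * g p"
  by (rule dderiv_eqI[OF has_derivative_mult[OF has_derivative_dderiv has_derivative_dderiv]])

lemma dderiv_sum:
  assumes "\<And>i. i \<in> I \<Longrightarrow> f i differentiable (at p)"
  shows "dderiv (\<lambda>q. \<Sum>i\<in>I. f i q) v p = (\<Sum>i\<in>I. dderiv (f i) v p)"
  by (rule dderiv_eqI[OF has_derivative_sum[OF has_derivative_dderiv[OF assms]]])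

definition bracket ::
  "('a::real_normed_vector \<Rightarrow> 'a) \<Rightarrow> ('a \<Rightarrow> 'a) \<Rightarrow> 'a \<Rightarrow> 'a" where
  "bracket X Y p = dderiv Y (X p) p - dderiv X (Y p) p"

lemma bracket_antisym: "bracket X Y p = - bracket Y X p"
  by (simp add: bracket_def)

text \<open>
  The two boolean indices of \<open>V\<close> are the unprimed and the primed spinor index. The assumption
  \<open>divergence_free\<close> says that the frame fields preserve the volume form taking the value \<open>h\<close> on them.
\<close>

locale lax_frame =
  fixes M :: "'a::euclidean_space set"
    and V :: "bool \<Rightarrow> bool \<Rightarrow> 'a \<Rightarrow> 'a"
    and e :: "bool \<Rightarrow> bool \<Rightarrow> 'a \<Rightarrow> 'a \<Rightarrow> real"
    and h :: "'a \<Rightarrow> real"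
  assumes open_M: "open M"
    and smooth_V: "\<And>A A'. smooth_on M (V A A')"
    and smooth_e: "\<And>A A' v. smooth_on M (\<lambda>p. e A A' p v)"
    and smooth_h: "smooth_on M h"
    and h_nonzero: "\<And>p. p \<in> M \<Longrightarrow> h p \<noteq> 0"
    and linear_e: "\<And>A A' p. p \<in> M \<Longrightarrow> linear (e A A' p)"
    and dual: "\<And>A A' B B' p. p \<in> M \<Longrightarrow>
      e A A' p (V B B' p) = (if A = B \<and> A' = B' then 1 else 0)"
    and frame_expansion: "\<And>p v. p \<in> M \<Longrightarrow>
      (\<Sum>A\<in>UNIV. \<Sum>A'\<in>UNIV. e A A' p v *\<^sub>R V A A' p) = v"
    and lax_same: "\<And>A B A' p. p \<in> M \<Longrightarrow> bracket (V A A') (V B A') p = 0"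
    and lax_mixed: "\<And>p. p \<in> M \<Longrightarrow>
      bracket (V False False) (V True True) p = bracket (V True False) (V False True) p"
    and divergence_free: "\<And>A A' p. p \<in> M \<Longrightarrow> dderiv h (V A A' p) p =
      h p * (\<Sum>B\<in>UNIV. \<Sum>B'\<in>UNIV. e B B' p (bracket (V A A') (V B B') p))"
begin

text \<open>Every \<open>V A A'\<close> is null and pairs only with
  \<open>V (\<not> A) (\<not> A')\<close>, the value being \<open>h / 2\<close> if the two indices
  agree and \<open>- h / 2\<close> otherwise.\<close>

definition met :: "'a metric" where
  "met p u v = h p / 2 *
    (e False False p u * e True True p v + e True True p u * e False False p v
     - e False True p u * e True False p v - e True False p u * e False True p v)"

lemma frame_eqI:
  assumes "p \<in> M" "linear f" "linear g" "\<And>A A'. f (V A A' p) = g (V A A' p)"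
  shows "f v = g v"
proof -
  have "f (\<Sum>A\<in>UNIV. \<Sum>A'\<in>UNIV. e A A' p v *\<^sub>R V A A' p)
      = g (\<Sum>A\<in>UNIV. \<Sum>A'\<in>UNIV. e A A' p v *\<^sub>R V A A' p)"
    using assms(4) by (simp add: linear_sum[OF assms(2)] linear_sum[OF assms(3)]
        linear_cmul[OF assms(2)] linear_cmul[OF assms(3)])
  then show ?thesis by (simp add: frame_expansion[OF assms(1)])
qed

lemma coframe_eqI:
  assumes "p \<in> M" "\<And>A A'. e A A' p v = e A A' p w"
  shows "v = w"
proof -
  have "v = (\<Sum>A\<in>UNIV. \<Sum>A'\<in>UNIV. e A A' p w *\<^sub>R V A A' p)"
    by (simp only: assms(2)[symmetric] frame_expansion[OF assms(1)])
  then show ?thesis by (simp only: frame_expansion[OF assms(1)])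
qed

lemmas e_simps = linear_add[OF linear_e] linear_diff[OF linear_e] linear_cmul[OF linear_e]
  linear_sum[OF linear_e] linear_neg[OF linear_e] linear_0[OF linear_e]

lemma coframe_combination:
  assumes "p \<in> M"
  shows "e A A' p (\<Sum>C\<in>UNIV. \<Sum>C'\<in>UNIV. c C C' *\<^sub>R V C C' p) = c A A'"
  using assms by (cases A; cases A') (simp_all add: e_simps dual UNIV_bool)

lemma differentiable_e: "p \<in> M \<Longrightarrow> (\<lambda>q. e A A' q v) differentiable (at p)"
  using smooth_e smooth_on_imp_differentiable by blast

lemma e_Basis: "p \<in> M \<Longrightarrow> e A A' p v = (\<Sum>b\<in>Basis. (v \<bullet> b) * e A A' p b)"
  using e_simps(4)[of p A A' "\<lambda>b. (v \<bullet> b) *\<^sub>R b" Basis]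
  by (simp add: euclidean_representation e_simps)

text \<open>Smoothness of the coframe is given for fixed arguments, so a moving argument is resolved
  into its coordinates first.\<close>

lemma smooth_e_along:
  assumes "smooth_on M X"
  shows "smooth_on M (\<lambda>p. e A A' p (X p))"
proof (rule smooth_on_cong[OF open_M])
  show "smooth_on M (\<lambda>p. \<Sum>b\<in>Basis. (X p \<bullet> b) * e A A' p b)"
    by (intro smooth_intros smooth_e open_M assms)
qed (rule e_Basis[symmetric])

lemma dderiv_e_along:
  assumes "p \<in> M" "smooth_on M X"
  shows "dderiv (\<lambda>q. e A A' q (X q)) u p
    = dderiv (\<lambda>q. e A A' q (X p)) u p + e A A' p (dderiv X u p)"
proof -
  have X: "X differentiable (at p)" by (rule smooth_on_imp_differentiable[OF assms(2,1)])
  have Xb: "(\<lambda>q. X q \<bullet> b) differentiable (at p)"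
    and DXb: "dderiv (\<lambda>q. X q \<bullet> b) u p = dderiv X u p \<bullet> b" for b
    using bounded_linear.has_derivative[OF bounded_linear_inner_left has_derivative_dderiv[OF X], of b]
    by (rule differentiableI, rule dderiv_eqI)
  have "dderiv (\<lambda>q. e A A' q (X q)) u p = dderiv (\<lambda>q. \<Sum>b\<in>Basis. (X q \<bullet> b) * e A A' q b) u p"
    by (rule dderiv_cong_open[OF open_M assms(1)]) (rule e_Basis)
  also have "\<dots> = (\<Sum>b\<in>Basis. (X p \<bullet> b) * dderiv (\<lambda>q. e A A' q b) u p + (dderiv X u p \<bullet> b) * e A A' p b)"
    by (subst dderiv_sum)
      (simp_all add: dderiv_mult DXb Xb differentiable_e assms(1) differentiable_mult)
  also have "\<dots> = (\<Sum>b\<in>Basis. (X p \<bullet> b) * dderiv (\<lambda>q. e A A' q b) u p) + e A A' p (dderiv X u p)"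
    by (simp add: sum.distrib e_Basis[OF assms(1), of _ _ "dderiv X u p"])
  also have "(\<Sum>b\<in>Basis. (X p \<bullet> b) * dderiv (\<lambda>q. e A A' q b) u p)
      = dderiv (\<lambda>q. \<Sum>b\<in>Basis. (X p \<bullet> b) * e A A' q b) u p"
    by (subst dderiv_sum)
      (simp_all add: dderiv_mult differentiable_e assms(1) differentiable_mult
        dderiv_eqI[OF has_derivative_const])
  also have "\<dots> = dderiv (\<lambda>q. e A A' q (X p)) u p"
    by (rule dderiv_cong_open[OF open_M assms(1)]) (rule e_Basis[symmetric])
  finally show ?thesis .
qed

lemma linear_dderiv_e_direction: "p \<in> M \<Longrightarrow> linear (\<lambda>u. dderiv (\<lambda>q. e A A' q v) u p)"
  by (rule linear_dderiv[OF differentiable_e])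

lemma linear_dderiv_parameter:
  fixes f :: "'a \<Rightarrow> 'a \<Rightarrow> real"
  assumes "p \<in> M" "\<And>q. q \<in> M \<Longrightarrow> linear (f q)" "\<And>v. (\<lambda>q. f q v) differentiable (at p)"
  shows "linear (\<lambda>v. dderiv (\<lambda>q. f q v) u p)"
proof (rule linearI)
  fix v w :: 'a and c :: real
  have "dderiv (\<lambda>q. f q (v + w)) u p = dderiv (\<lambda>q. f q v + f q w) u p"
    by (rule dderiv_cong_open[OF open_M assms(1)]) (simp add: linear_add assms(2))
  then show "dderiv (\<lambda>q. f q (v + w)) u p = dderiv (\<lambda>q. f q v) u p + dderiv (\<lambda>q. f q w) u p"
    by (simp add: dderiv_add assms(3))
  have "dderiv (\<lambda>q. f q (c *\<^sub>R v)) u p = dderiv (\<lambda>q. c * f q v) u p"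
    by (rule dderiv_cong_open[OF open_M assms(1)]) (simp add: linear_cmul assms(2))
  then show "dderiv (\<lambda>q. f q (c *\<^sub>R v)) u p = c *\<^sub>R dderiv (\<lambda>q. f q v) u p"
    by (simp add: dderiv_mult assms(3) dderiv_eqI[OF has_derivative_const])
qed

lemma linear_dderiv_e: "p \<in> M \<Longrightarrow> linear (\<lambda>v. dderiv (\<lambda>q. e A A' q v) u p)"
  by (rule linear_dderiv_parameter) (auto intro: linear_e differentiable_e)

text \<open>
  The connection with \<open>\<nabla>\<^sub>u (V B B') = (\<Sum>C. conn B C u *\<^sub>R V C B')\<close>, so that the primed index is
  parallel. Vanishing torsion determines \<open>conn\<close>.
\<close>

definition conn_frame :: "bool \<Rightarrow> bool \<Rightarrow> bool \<Rightarrow> bool \<Rightarrow> 'a \<Rightarrow> real" where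
  "conn_frame A A' B C p =
    (if A' then - e C False p (bracket (V B False) (V A True) p)
     else e C True p (bracket (V A False) (V B True) p))"

definition conn :: "bool \<Rightarrow> bool \<Rightarrow> 'a \<Rightarrow> 'a \<Rightarrow> real" where
  "conn B C p u = (\<Sum>A\<in>UNIV. \<Sum>A'\<in>UNIV. e A A' p u * conn_frame A A' B C p)"

text \<open>The covariant derivative of the constant field \<open>v\<close>. Its frame components
  vary from point to point, which gives the derivative term.\<close>

definition nabla :: "'a \<Rightarrow> 'a \<Rightarrow> 'a \<Rightarrow> 'a" where
  "nabla p u v = (\<Sum>C\<in>UNIV. \<Sum>C'\<in>UNIV.
    (dderiv (\<lambda>q. e C C' q v) u p + (\<Sum>B\<in>UNIV. conn B C p u * e B C' p v)) *\<^sub>R V C C' p)"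

lemma smooth_conn: "smooth_on M (\<lambda>p. conn B C p u)"
proof -
  have "smooth_on M (conn_frame A A' B C)" for A A'
    unfolding conn_frame_def bracket_def
    by (cases A') (auto intro!: smooth_intros smooth_e_along smooth_V open_M)
  then show ?thesis
    unfolding conn_def by (intro smooth_intros open_M smooth_e) auto
qed

lemma differentiable_conn: "p \<in> M \<Longrightarrow> (\<lambda>q. conn B C q u) differentiable (at p)"
  using smooth_conn smooth_on_imp_differentiable by blast

lemma linear_conn: "p \<in> M \<Longrightarrow> linear (conn B C p)"
  by (rule linearI)
    (simp_all add: conn_def e_simps sum.distrib distrib_right sum_distrib_left mult.assoc)

lemma conn_V: "p \<in> M \<Longrightarrow> conn B C p (V A A' p) = conn_frame A A' B C p"
  by (cases A; cases A') (simp_all add: conn_def dual UNIV_bool)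

lemma e_nabla:
  "p \<in> M \<Longrightarrow> e C C' p (nabla p u v)
    = dderiv (\<lambda>q. e C C' q v) u p + (\<Sum>B\<in>UNIV. conn B C p u * e B C' p v)"
  unfolding nabla_def by (rule coframe_combination)

lemma smooth_nabla: "smooth_on M (\<lambda>p. nabla p u v)"
  unfolding nabla_def
  by (intro smooth_intros open_M smooth_e smooth_conn smooth_V)

lemma linear_nabla_direction: "p \<in> M \<Longrightarrow> linear (\<lambda>u. nabla p u v)"
  by (rule linearI; rule coframe_eqI, assumption)
    (simp_all add: e_nabla e_simps linear_add[OF linear_dderiv_e_direction]
      linear_cmul[OF linear_dderiv_e_direction] linear_add[OF linear_conn]
      linear_cmul[OF linear_conn] sum.distrib algebra_simps sum_distrib_left)

lemmas linear_simps =
  e_simps(1,3)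
  linear_add[OF linear_dderiv_e_direction] linear_cmul[OF linear_dderiv_e_direction]
  linear_add[OF linear_dderiv_e] linear_cmul[OF linear_dderiv_e]
  linear_add[OF linear_conn] linear_cmul[OF linear_conn]

lemma linear_nabla: "p \<in> M \<Longrightarrow> linear (\<lambda>v. nabla p u v)"
  by (rule linearI; rule coframe_eqI, assumption)
    (simp_all add: e_nabla linear_simps sum.distrib algebra_simps sum_distrib_left)

text \<open>The pairings in \<open>dual\<close> are constant, so the derivatives of coframe and
  frame cancel.\<close>

lemma dderiv_e_V:
  assumes "p \<in> M"
  shows "dderiv (\<lambda>q. e A A' q (V B B' p)) u p = - e A A' p (dderiv (V B B') u p)"
proof -
  have "dderiv (\<lambda>q. e A A' q (V B B' q)) u p
      = dderiv (\<lambda>q. if A = B \<and> A' = B' then 1 else 0) u p"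
    by (rule dderiv_cong_open[OF open_M assms]) (rule dual)
  also have "\<dots> = 0" by (rule dderiv_eqI[OF has_derivative_const])
  finally show ?thesis using dderiv_e_along[OF assms smooth_V] by simp
qed

text \<open>\<open>nabla\<close> treats \<open>V B B' p\<close> as a constant field. Compared with
  the field \<open>V B B'\<close> itself this loses the derivative of the latter, hence the last
  term.\<close>

lemma e_nabla_V:
  assumes "p \<in> M"
  shows "e C C' p (nabla p (V A A' p) (V B B' p))
    = (if B' = C' then conn_frame A A' B C p else 0) - e C C' p (dderiv (V B B') (V A A' p) p)"
proof -
  have "(\<Sum>D\<in>UNIV. conn D C p (V A A' p) * e D C' p (V B B' p))
      = (if B' = C' then conn_frame A A' B C p else 0)"
    by (cases B) (simp_all add: UNIV_bool dual conn_V assms)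
  then show ?thesis by (simp add: e_nabla dderiv_e_V assms)
qed

text \<open>Vanishing torsion in the frame. For different primed indices it is the definition of
  \<open>conn_frame\<close>. For equal ones the left side is zero by \<open>lax_same\<close>, and
  the right side is zero because \<open>lax_mixed\<close> makes
  \<open>bracket (V A False) (V B True)\<close> symmetric in \<open>A\<close> and
  \<open>B\<close>.\<close>

lemma e_bracket:
  assumes "p \<in> M"
  shows "e C C' p (bracket (V A A') (V B B') p)
    = (if B' = C' then conn_frame A A' B C p else 0) - (if A' = C' then conn_frame B B' A C p else 0)"
proof -
  have mixed: "bracket (V A False) (V B True) p = bracket (V B False) (V A True) p" for A B
    using lax_mixed[OF assms] by (cases A; cases B) auto
  consider "A' = B'" | "\<not> A'" "B'" | "A'" "\<not> B'" by blast
  then show ?thesis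
  proof cases
    case 1
    then show ?thesis
      using mixed[of A B] by (cases A'; cases C') (simp_all add: lax_same conn_frame_def e_simps assms)
  next
    case 2
    then show ?thesis by (cases C') (simp_all add: conn_frame_def)
  next
    case 3
    then show ?thesis
      using bracket_antisym[of "V A True" "V B False" p]
      by (cases C') (simp_all add: conn_frame_def e_simps assms)
  qed
qed

text \<open>Constant fields commute, so this symmetry is the absence of torsion. On frame vectors
  the derivative terms of \<open>e_nabla_V\<close> combine to the bracket.\<close>

lemma nabla_sym:
  assumes "p \<in> M"
  shows "nabla p u v = nabla p v u"
proof (rule frame_eqI[OF assms linear_nabla[OF assms] linear_nabla_direction[OF assms], of u u v])
  fix B B'
  show "nabla p u (V B B' p) = nabla p (V B B' p) u"
  proof (rule frame_eqI[OF assms linear_nabla_direction[OF assms] linear_nabla[OF assms],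
        of "V B B' p" "V B B' p" u])
    fix A A'
    show "nabla p (V A A' p) (V B B' p) = nabla p (V B B' p) (V A A' p)"
    proof (rule coframe_eqI[OF assms])
      fix C C'
      show "e C C' p (nabla p (V A A' p) (V B B' p)) = e C C' p (nabla p (V B B' p) (V A A' p))"
        using e_bracket[OF assms, of C C' A A' B B']
        unfolding e_nabla_V[OF assms] bracket_def e_simps(2)[OF assms] by linarith
    qed
  qed
qed

text \<open>In \<open>divergence_free\<close> only brackets with different primed indices survive,
  and their diagonal components are the coefficients \<open>conn_frame A A' B B\<close>; the
  divergence is thus the trace of the connection.\<close>

lemma conn_trace:
  assumes "p \<in> M"
  shows "conn False False p u + conn True True p u = dderiv h u p / h p"
proof (rule frame_eqI[OF assms, of "\<lambda>u. conn False False p u + conn True True p u"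
      "\<lambda>u. dderiv h u p / h p" u])
  show "linear (\<lambda>u. conn False False p u + conn True True p u)"
    by (intro linear_compose_add linear_conn assms)
  have L: "linear (\<lambda>u. dderiv h u p)"
    using smooth_h assms by (intro linear_dderiv smooth_on_imp_differentiable)
  show "linear (\<lambda>u. dderiv h u p / h p)"
    by (rule linearI) (simp_all add: linear_add[OF L] linear_cmul[OF L] add_divide_distrib)
  fix A A'
  show "conn False False p (V A A' p) + conn True True p (V A A' p) = dderiv h (V A A' p) p / h p"
    using lax_same[OF assms]
    by (cases A'; simp add: divergence_free conn_V UNIV_bool e_simps assms h_nonzero)
      (simp_all add: e_bracket assms)
qed

section \<open>The metric and its Levi-Civita connection\<close>

lemma smooth_met: "smooth_on M (\<lambda>p. met p u v)"
  unfolding met_def by (intro smooth_intros open_M smooth_h smooth_e) auto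

lemma met_sym: "met p u v = met p v u"
  by (simp add: met_def)

lemma linear_met: "p \<in> M \<Longrightarrow> linear (met p u)"
  by (rule linearI) (simp_all add: met_def e_simps algebra_simps)

lemma linear_met_left: "p \<in> M \<Longrightarrow> linear (\<lambda>u. met p u v)"
  using linear_met by (simp add: met_sym[of p _ v])

lemma bilinear_met: "p \<in> M \<Longrightarrow> bilinear (met p)"
  by (simp add: bilinear_def linear_met linear_met_left)

text \<open>The coframe is recovered from the metric by pairing with the one frame vector of
  opposite indices; the factor inverts the pairing value. This gives nondegeneracy at once.\<close>

lemma e_met:
  assumes "p \<in> M"
  shows "e A A' p v = (if A = A' then 2 else - 2) / h p * met p v (V (\<not> A) (\<not> A') p)"
  using assms h_nonzero[OF assms]
  by (cases A; cases A') (simp_all add: met_def dual)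

lemma met_nondegenerate:
  assumes "p \<in> M" "\<And>w. met p v w = met p v' w"
  shows "v = v'"
  by (rule coframe_eqI[OF assms(1)]) (simp add: e_met assms)

text \<open>The off-diagonal entries of \<open>conn\<close> cancel, since they preserve \<epsilon>.
  The diagonal ones add up to the trace, which \<open>conn_trace\<close> balances against the
  derivative of \<open>h\<close>.\<close>

lemma met_parallel:
  assumes "p \<in> M"
  shows "dderiv (\<lambda>q. met q u v) w p = met p (nabla p w u) v + met p u (nabla p w v)"
proof -
  have he: "((\<lambda>q. e A A' q u) has_derivative (\<lambda>w. dderiv (\<lambda>q. e A A' q u) w p)) (at p)" for A A' u
    by (rule has_derivative_dderiv[OF differentiable_e[OF assms]])
  have hh: "((\<lambda>q. h q / 2) has_derivative (\<lambda>w. dderiv h w p / 2)) (at p)"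
    by (rule bounded_linear.has_derivative[OF bounded_linear_divide
          smooth_on_has_derivative[OF smooth_h assms]])
  have "((\<lambda>q. met q u v) has_derivative (\<lambda>w. dderiv h w p / 2 *
      (e False False p u * e True True p v + e True True p u * e False False p v
       - e False True p u * e True False p v - e True False p u * e False True p v)
    + h p / 2 *
      (dderiv (\<lambda>q. e False False q u) w p * e True True p v + e False False p u * dderiv (\<lambda>q. e True True q v) w p
       + (dderiv (\<lambda>q. e True True q u) w p * e False False p v + e True True p u * dderiv (\<lambda>q. e False False q v) w p)
       - (dderiv (\<lambda>q. e False True q u) w p * e True False p v + e False True p u * dderiv (\<lambda>q. e True False q v) w p)
       - (dderiv (\<lambda>q. e True False q u) w p * e False True p v + e True False p u * dderiv (\<lambda>q. e False True q v) w p)))) (at p)"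
    unfolding met_def
    by (rule has_derivative_eq_rhs, (rule has_derivative_mult has_derivative_add
          has_derivative_diff he hh)+) (simp add: fun_eq_iff algebra_simps)
  note D = dderiv_eqI[OF this, of w]
  have Dh: "dderiv h w p = h p * (conn False False p w + conn True True p w)"
    using conn_trace[OF assms] h_nonzero[OF assms] by simp
  show ?thesis
    unfolding D Dh
    by (simp add: met_def e_nabla assms UNIV_bool algebra_simps add_divide_distrib diff_divide_distrib)
qed

text \<open>The Koszul formula for constant fields: parallelism of \<open>met\<close> and symmetry
  of \<open>nabla\<close> give the defining equation, nondegeneracy its unique solution.\<close>

lemma christoffel_met:
  assumes "p \<in> M"
  shows "christoffel met p u v = nabla p u v"
  unfolding christoffel_def sharp_def
proof (rule the_equality)
  have *: "(dderiv (\<lambda>q. met q v w) u p + dderiv (\<lambda>q. met q u w) v p - dderiv (\<lambda>q. met q u v) w p) / 2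
      = met p (nabla p u v) w" for w
    using met_sym[of p u "nabla p v w"] met_sym[of p v "nabla p u w"]
    by (simp add: met_parallel[OF assms] nabla_sym[OF assms, of v u] nabla_sym[OF assms, of w]
        met_sym[of p v] met_sym[of p u])
  then show "\<forall>w. met p (nabla p u v) w =
      (dderiv (\<lambda>q. met q v w) u p + dderiv (\<lambda>q. met q u w) v p - dderiv (\<lambda>q. met q u v) w p) / 2"
    by simp
  show "x = nabla p u v" if "\<forall>w. met p x w =
      (dderiv (\<lambda>q. met q v w) u p + dderiv (\<lambda>q. met q u w) v p - dderiv (\<lambda>q. met q u v) w p) / 2" for x
    by (rule met_nondegenerate[OF assms]) (simp only: that * )
qed


section \<open>Curvature and its symmetries\<close>

lemma riemann_met:
  assumes "p \<in> M"
  shows "riemann met p u v w =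
    dderiv (\<lambda>q. nabla q v w) u p + nabla p u (nabla p v w)
    - dderiv (\<lambda>q. nabla q u w) v p - nabla p v (nabla p u w)"
proof -
  have "dderiv (\<lambda>q. christoffel met q v w) u p = dderiv (\<lambda>q. nabla q v w) u p" for u v
    by (rule dderiv_cong_open[OF open_M assms]) (rule christoffel_met)
  then show ?thesis by (simp add: riemann_def christoffel_met assms)
qed

text \<open>With constant fields there are no bracket terms, and the twelve summands cancel in pairs
  by the symmetry of \<open>nabla\<close>.\<close>

lemma riemann_bianchi:
  assumes "p \<in> M"
  shows "riemann met p u v w + riemann met p v w u + riemann met p w u v = 0"
proof -
  have "dderiv (\<lambda>q. nabla q v w) u p = dderiv (\<lambda>q. nabla q w v) u p" for u v w
    by (rule dderiv_cong_open[OF open_M assms]) (rule nabla_sym)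
  from this[where u = u] this[where u = v] this[where u = w]
  show ?thesis
    unfolding riemann_met[OF assms]
    using nabla_sym[OF assms, of v w] nabla_sym[OF assms, of w u] nabla_sym[OF assms, of u v]
    by (simp add: algebra_simps)
qed

text \<open>The curvature two-form of the connection matrix \<open>conn\<close>, exterior derivative
  plus commutator, on constant \<open>u\<close> and \<open>v\<close>. \<open>B\<close> is the index
  acted on, \<open>C\<close> the resulting one.\<close>

definition curv :: "'a \<Rightarrow> 'a \<Rightarrow> 'a \<Rightarrow> bool \<Rightarrow> bool \<Rightarrow> real" where
  "curv p u v B C =
    dderiv (\<lambda>q. conn B C q v) u p - dderiv (\<lambda>q. conn B C q u) v p
    + (\<Sum>D\<in>UNIV. conn B D p v * conn D C p u - conn B D p u * conn D C p v)"

lemma curv_antisym: "curv p u v B C = - curv p v u B C"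
  by (simp add: curv_def UNIV_bool)

lemma linear_curv:
  assumes "p \<in> M"
  shows "linear (\<lambda>u. curv p u v B C)"
proof -
  have L: "linear (\<lambda>u. dderiv (\<lambda>q. conn B C q u) v p)" "linear (\<lambda>u. dderiv (\<lambda>q. conn B C q v) u p)"
    by (rule linear_dderiv_parameter[OF assms linear_conn differentiable_conn[OF assms]], assumption)
      (rule linear_dderiv[OF differentiable_conn[OF assms]])
  show ?thesis
    by (rule linearI) (simp_all add: curv_def linear_add[OF L(1)] linear_add[OF L(2)]
        linear_cmul[OF L(1)] linear_cmul[OF L(2)] linear_simps assms UNIV_bool algebra_simps)
qed

text \<open>The primed index is only carried along. Second derivatives of the coframe cancel by
  \<open>dderiv_commute\<close>, the terms with first derivatives are symmetric in \<open>u\<close>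
  and \<open>v\<close>, and what remains is the curvature of \<open>conn\<close>.\<close>

lemma e_riemann:
  assumes "p \<in> M"
  shows "e C C' p (riemann met p u v w) = (\<Sum>B\<in>UNIV. curv p u v B C * e B C' p w)"
proof -
  define D where "D A u = dderiv (\<lambda>q. e A C' q w) u p" for A u
  have 1: "e C C' p (dderiv (\<lambda>q. nabla q v w) u p + nabla p u (nabla p v w)) =
      dderiv (dderiv (\<lambda>q. e C C' q w) v) u p
      + (\<Sum>B\<in>UNIV. conn B C p v * D B u + dderiv (\<lambda>q. conn B C q v) u p * e B C' p w)
      + (\<Sum>B\<in>UNIV. conn B C p u * (D B v + (\<Sum>A\<in>UNIV. conn A B p v * e A C' p w)))" for u v
  proof -
    have "e C C' p (dderiv (\<lambda>q. nabla q v w) u p + nabla p u (nabla p v w)) =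
        dderiv (\<lambda>q. e C C' q (nabla q v w)) u p
        + (\<Sum>B\<in>UNIV. conn B C p u * e B C' p (nabla p v w))"
      by (simp add: dderiv_e_along[OF assms smooth_nabla] e_nabla[of p C C' u "nabla p v w"]
          e_simps(1) assms)
    also have "dderiv (\<lambda>q. e C C' q (nabla q v w)) u p = dderiv (\<lambda>q. dderiv (\<lambda>r. e C C' r w) v q
        + (\<Sum>B\<in>UNIV. conn B C q v * e B C' q w)) u p"
      by (rule dderiv_cong_open[OF open_M assms]) (rule e_nabla)
    also have "\<dots> = dderiv (dderiv (\<lambda>q. e C C' q w) v) u p
        + (\<Sum>B\<in>UNIV. conn B C p v * D B u + dderiv (\<lambda>q. conn B C q v) u p * e B C' p w)"
    proof -
      have 2: "(\<lambda>q. conn B C q v * e B C' q w) differentiable (at p)" for B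
        by (intro differentiable_mult differentiable_conn differentiable_e assms)
      have 3: "dderiv (\<lambda>r. e C C' r w) v differentiable (at p)"
        by (rule smooth_on_imp_differentiable[OF smooth_on_dderiv[OF smooth_e] assms])
      show ?thesis
        by (subst dderiv_add[OF 3 differentiable_sum], simp_all add: 2 dderiv_sum)
          (simp add: dderiv_mult differentiable_conn differentiable_e assms D_def)
    qed
    finally show ?thesis by (simp add: e_nabla assms D_def)
  qed
  have 4: "riemann met p u v w = (dderiv (\<lambda>q. nabla q v w) u p + nabla p u (nabla p v w))
      - (dderiv (\<lambda>q. nabla q u w) v p + nabla p v (nabla p u w))"
    by (simp add: riemann_met[OF assms])
  show ?thesis
    unfolding 4 e_simps(2)[OF assms] 1 dderiv_commute[OF open_M assms smooth_e, of C C' w v u]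
    by (simp add: curv_def UNIV_bool algebra_simps)
qed

text \<open>The trace of \<open>conn\<close> is the logarithmic differential of \<open>h\<close>, a
  closed form, and commutators have no trace.\<close>

lemma curv_trace:
  assumes "p \<in> M"
  shows "curv p u v False False + curv p u v True True = 0"
proof -
  have h: "h differentiable (at p)" and Dh: "dderiv h v differentiable (at p)" for v
    using smooth_on_imp_differentiable[OF _ assms] smooth_h smooth_on_dderiv by blast+
  have "dderiv (\<lambda>q. conn False False q v) u p + dderiv (\<lambda>q. conn True True q v) u p
      = (dderiv (dderiv h v) u p * h p - dderiv h v p * dderiv h u p) / (h p * h p)" for u v
  proof -
    have "dderiv (\<lambda>q. conn False False q v) u p + dderiv (\<lambda>q. conn True True q v) u p
        = dderiv (\<lambda>q. conn False False q v + conn True True q v) u p"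
      by (simp add: dderiv_add differentiable_conn assms)
    also have "\<dots> = dderiv (\<lambda>q. dderiv h v q / h q) u p"
      by (rule dderiv_cong_open[OF open_M assms]) (rule conn_trace)
    also have "\<dots> = (dderiv (dderiv h v) u p * h p - dderiv h v p * dderiv h u p) / (h p * h p)"
      by (rule dderiv_eqI[OF has_derivative_divide'[OF has_derivative_dderiv[OF Dh]
              has_derivative_dderiv[OF h] h_nonzero[OF assms]]])
    finally show ?thesis .
  qed
  from this[of v u] this[of u v] show ?thesis
    using dderiv_commute[OF open_M assms smooth_h, of u v]
    by (simp add: curv_def UNIV_bool algebra_simps)
qed

text \<open>
  The Bianchi identity alone confines the curvature to the totally symmetric part of
  \<open>curv (V A False) (V B True) C\<close>, the self-dual Weyl spinor.
\<close>

lemma curv_cyclic: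
  assumes "p \<in> M"
  shows "(if C' = D' then curv p (V A A' p) (V B B' p) C D else 0)
    + (if A' = D' then curv p (V B B' p) (V C C' p) A D else 0)
    + (if B' = D' then curv p (V C C' p) (V A A' p) B D else 0) = 0"
proof -
  have *: "e D D' p (riemann met p u v (V C C' p)) = (if C' = D' then curv p u v C D else 0)" for C C' u v
    unfolding e_riemann[OF assms] by (cases C) (simp_all add: UNIV_bool dual assms)
  have "e D D' p (riemann met p (V A A' p) (V B B' p) (V C C' p)
      + riemann met p (V B B' p) (V C C' p) (V A A' p)
      + riemann met p (V C C' p) (V A A' p) (V B B' p)) = 0"
    by (simp only: riemann_bianchi[OF assms] e_simps(6)[OF assms])
  then show ?thesis by (simp only: e_simps(1)[OF assms] * )
qed

text \<open>A third frame vector with the opposite primed index leaves a single term of the cyclic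
  sum.\<close>

lemma curv_same:
  assumes "p \<in> M"
  shows "curv p (V A A' p) (V B A' p) C D = 0"
  using curv_cyclic[OF assms, of "\<not> A'" "\<not> A'" A A' B A' C D] by simp

text \<open>Giving the third vector the primed index of one argument kills one of the three terms;
  the other two exchange its unprimed index with that of this argument. The two transpositions
  generate all permutations of \<open>A\<close>, \<open>B\<close>, \<open>C\<close>.\<close>

lemma curv_mixed_swap:
  assumes "p \<in> M"
  shows "curv p (V A False p) (V B True p) C D = curv p (V C False p) (V B True p) A D"
    and "curv p (V A False p) (V B True p) C D = curv p (V A False p) (V C True p) B D"
  using curv_cyclic[OF assms, of False False A False B True C D]
    curv_cyclic[OF assms, of True True A False B True C D]
    curv_antisym[of p "V B True p" "V C False p" A D]
    curv_antisym[of p "V C True p" "V A False p" B D]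
  by simp_all

lemma curv_self_dual:
  "p \<in> M \<Longrightarrow> curv p (V False False p) (V True True p) C D = curv p (V True False p) (V False True p) C D"
  using curv_mixed_swap by metis

lemma linear_riemann:
  assumes "p \<in> M"
  shows "linear (\<lambda>u. riemann met p u v w)"
  by (rule linearI; rule coframe_eqI[OF assms])
    (simp_all add: e_riemann linear_add[OF linear_curv] linear_cmul[OF linear_curv] e_simps assms
      UNIV_bool algebra_simps)

text \<open>Both sides are the trace of \<open>L\<close>; this moves the contraction in
  \<open>ricci\<close> to the frame.\<close>

lemma sum_Basis_frame:
  assumes "p \<in> M" "linear L"
  shows "(\<Sum>b\<in>Basis. L b \<bullet> b) = (\<Sum>A\<in>UNIV. \<Sum>A'\<in>UNIV. e A A' p (L (V A A' p)))"
proof -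
  have "(\<Sum>b\<in>Basis. L b \<bullet> b)
      = (\<Sum>b\<in>Basis. \<Sum>A\<in>UNIV. \<Sum>A'\<in>UNIV. (V A A' p \<bullet> b) * e A A' p (L b))"
  proof (rule sum.cong[OF refl])
    fix b
    have "L b \<bullet> b = (\<Sum>A\<in>UNIV. \<Sum>A'\<in>UNIV. e A A' p (L b) *\<^sub>R V A A' p) \<bullet> b"
      by (simp only: frame_expansion[OF assms(1)])
    then show "L b \<bullet> b = (\<Sum>A\<in>UNIV. \<Sum>A'\<in>UNIV. (V A A' p \<bullet> b) * e A A' p (L b))"
      by (simp only: inner_sum_left inner_scaleR_left mult.commute)
  qed
  also have "\<dots> = (\<Sum>A\<in>UNIV. \<Sum>A'\<in>UNIV. \<Sum>b\<in>Basis. (V A A' p \<bullet> b) * e A A' p (L b))"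
    by (subst sum.swap, rule sum.cong[OF refl], rule sum.swap)
  also have "\<dots> = (\<Sum>A\<in>UNIV. \<Sum>A'\<in>UNIV. e A A' p (L (\<Sum>b\<in>Basis. (V A A' p \<bullet> b) *\<^sub>R b)))"
    by (simp only: linear_sum[OF assms(2)] linear_cmul[OF assms(2)] e_simps(3,4)[OF assms(1)]
        real_scaleR_def)
  finally show ?thesis by (simp only: euclidean_representation)
qed

lemma ricci_flat:
  assumes "p \<in> M"
  shows "ricci met p v w = 0"
proof -
  have "ricci met p v w
      = (\<Sum>A\<in>UNIV. \<Sum>A'\<in>UNIV. \<Sum>B\<in>UNIV. curv p (V A A' p) v B A * e B A' p w)"
    unfolding ricci_def by (simp only: sum_Basis_frame[OF assms linear_riemann[OF assms]] e_riemann[OF assms])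
  also have "\<dots> = (\<Sum>A'\<in>UNIV. \<Sum>B\<in>UNIV. (\<Sum>A\<in>UNIV. curv p (V A A' p) v B A) * e B A' p w)"
    by (simp add: UNIV_bool algebra_simps)
  also have "\<dots> = 0"
  proof -
    have "(\<Sum>A\<in>UNIV. curv p (V A A' p) v B A) = 0" for A' B
    proof (rule frame_eqI[OF assms, of "\<lambda>v. \<Sum>A\<in>UNIV. curv p (V A A' p) v B A" "\<lambda>_. 0" v])
      have "linear (\<lambda>v. curv p u v B A)" for u A
        using linear_compose_neg[OF linear_curv[OF assms, of u B A]] by (simp only: curv_antisym[of p _ u] minus_minus)
      then show "linear (\<lambda>v. \<Sum>A\<in>UNIV. curv p (V A A' p) v B A)"
        by (intro linear_compose_sum) simp
      fix C C'
      show "(\<Sum>A\<in>UNIV. curv p (V A A' p) (V C C' p) B A) = 0"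
      proof (cases "A' = C'")
        case True
        then show ?thesis by (simp add: curv_same assms)
      next
        case False
        \<comment> \<open>Permuting the symmetric indices turns the contraction of an argument with
          the output index into the trace over the acted-on and output index, which vanishes by
          \<open>curv_trace\<close>.\<close>
        have "curv p (V A A' p) (V C C' p) B A
            = (if A' then - curv p (V C C' p) (V B A' p) A A else curv p (V B A' p) (V C C' p) A A)" for A
          using False curv_mixed_swap[OF assms, of A C B A] curv_mixed_swap[OF assms, of C A B A]
            curv_antisym[of p "V A A' p" "V C C' p" B A]
          by (cases A'; cases C') simp_all
        then show ?thesis
          using curv_trace[OF assms, of "V C C' p" "V B True p"]
            curv_trace[OF assms, of "V B False p" "V C C' p"]
          by (cases A') (simp_all add: UNIV_bool)
      qed
    qed (rule linear_zero)
    then show ?thesis by simp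
  qed
  finally show ?thesis .
qed

lemma weyl_met:
  assumes "p \<in> M"
  shows "weyl met p u v w t = met p (riemann met p u v w) t"
  by (simp add: weyl_def scalar_curv_def ricci_flat assms)

text \<open>With Ricci curvature gone the Weyl tensor is the Riemann tensor, so the symmetries of
  \<open>curv\<close> say that its part antisymmetric in the unprimed index is zero.\<close>

lemma weyl_frame:
  assumes "p \<in> M"
  shows "weyl met p (V A A' p) (V B A' p) w t = 0"
    and "weyl met p (V False False p) (V True True p) w t
      = weyl met p (V True False p) (V False True p) w t"
proof -
  have "riemann met p (V A A' p) (V B A' p) w = 0"
    by (rule coframe_eqI[OF assms]) (simp add: e_riemann e_simps curv_same assms)
  then show "weyl met p (V A A' p) (V B A' p) w t = 0"
    by (simp add: weyl_met assms met_def e_simps)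
  have "riemann met p (V False False p) (V True True p) w
      = riemann met p (V True False p) (V False True p) w"
    by (rule coframe_eqI[OF assms]) (simp add: e_riemann curv_self_dual assms)
  then show "weyl met p (V False False p) (V True True p) w t
      = weyl met p (V True False p) (V False True p) w t"
    by (simp add: weyl_met assms)
qed

end

subsection \<open>Hodge duality in four dimensions\<close>

lemma vector_4:
  "(vector [a, b, c, d] :: 'a::zero^4) $ 1 = a" "(vector [a, b, c, d] :: 'a^4) $ 2 = b"
  "(vector [a, b, c, d] :: 'a^4) $ 3 = c" "(vector [a, b, c, d] :: 'a^4) $ 4 = d"
  unfolding vector_def by simp_all

lemma det_4:
  "det (A :: 'a::comm_ring_1^4^4) =
    A$1$1 * (A$2$2 * (A$3$3 * A$4$4 - A$3$4 * A$4$3) - A$2$3 * (A$3$2 * A$4$4 - A$3$4 * A$4$2)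
      + A$2$4 * (A$3$2 * A$4$3 - A$3$3 * A$4$2))
    - A$1$2 * (A$2$1 * (A$3$3 * A$4$4 - A$3$4 * A$4$3) - A$2$3 * (A$3$1 * A$4$4 - A$3$4 * A$4$1)
      + A$2$4 * (A$3$1 * A$4$3 - A$3$3 * A$4$1))
    + A$1$3 * (A$2$1 * (A$3$2 * A$4$4 - A$3$4 * A$4$2) - A$2$2 * (A$3$1 * A$4$4 - A$3$4 * A$4$1)
      + A$2$4 * (A$3$1 * A$4$2 - A$3$2 * A$4$1))
    - A$1$4 * (A$2$1 * (A$3$2 * A$4$3 - A$3$3 * A$4$2) - A$2$2 * (A$3$1 * A$4$3 - A$3$3 * A$4$1)
      + A$2$3 * (A$3$1 * A$4$2 - A$3$2 * A$4$1))"
proof -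
  have f: "finite {2::4, 3, 4}" "1 \<notin> {2::4, 3, 4}" "finite {3::4, 4}" "2 \<notin> {3::4, 4}"
    "finite {4::4}" "3 \<notin> {4::4}"
    by auto
  show ?thesis
    unfolding det_def UNIV_4
    unfolding sum_over_permutations_insert[OF f(1,2)]
    unfolding sum_over_permutations_insert[OF f(3,4)]
    unfolding sum_over_permutations_insert[OF f(5,6)]
    unfolding permutes_sing
    by (simp add: sign_swap_id permutation_swap_id permutation_compose sign_compose sign_id swap_id_eq
        algebra_simps)
qed

lemma wedge4_expand:
  "wedge4 \<alpha> \<beta> \<gamma> \<delta> u v w t =
    \<alpha> u * (\<beta> v * (\<gamma> w * \<delta> t - \<gamma> t * \<delta> w) - \<beta> w * (\<gamma> v * \<delta> t - \<gamma> t * \<delta> v) + \<beta> t * (\<gamma> v * \<delta> w - \<gamma> w * \<delta> v))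
    - \<alpha> v * (\<beta> u * (\<gamma> w * \<delta> t - \<gamma> t * \<delta> w) - \<beta> w * (\<gamma> u * \<delta> t - \<gamma> t * \<delta> u) + \<beta> t * (\<gamma> u * \<delta> w - \<gamma> w * \<delta> u))
    + \<alpha> w * (\<beta> u * (\<gamma> v * \<delta> t - \<gamma> t * \<delta> v) - \<beta> v * (\<gamma> u * \<delta> t - \<gamma> t * \<delta> u) + \<beta> t * (\<gamma> u * \<delta> v - \<gamma> v * \<delta> u))
    - \<alpha> t * (\<beta> u * (\<gamma> v * \<delta> w - \<gamma> w * \<delta> v) - \<beta> v * (\<gamma> u * \<delta> w - \<gamma> w * \<delta> u) + \<beta> w * (\<gamma> u * \<delta> v - \<gamma> v * \<delta> u))"
  by (simp add: wedge4_def det_4 vector_4)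

lemma vol_form_permute:
  "vol_form g s p u v t w = - vol_form g s p u v w t" "vol_form g s p u w v t = - vol_form g s p u v w t"
  "vol_form g s p u w t v = vol_form g s p u v w t" "vol_form g s p u t v w = vol_form g s p u v w t"
  "vol_form g s p u t w v = - vol_form g s p u v w t" "vol_form g s p v u w t = - vol_form g s p u v w t"
  "vol_form g s p v u t w = vol_form g s p u v w t" "vol_form g s p v w u t = vol_form g s p u v w t"
  "vol_form g s p v w t u = - vol_form g s p u v w t" "vol_form g s p v t u w = - vol_form g s p u v w t"
  "vol_form g s p v t w u = vol_form g s p u v w t" "vol_form g s p w u v t = vol_form g s p u v w t"
  "vol_form g s p w u t v = - vol_form g s p u v w t" "vol_form g s p w v u t = - vol_form g s p u v w t"
  "vol_form g s p w v t u = vol_form g s p u v w t" "vol_form g s p w t u v = vol_form g s p u v w t"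
  "vol_form g s p w t v u = - vol_form g s p u v w t" "vol_form g s p t u v w = - vol_form g s p u v w t"
  "vol_form g s p t u w v = vol_form g s p u v w t" "vol_form g s p t v u w = vol_form g s p u v w t"
  "vol_form g s p t v w u = - vol_form g s p u v w t" "vol_form g s p t w u v = - vol_form g s p u v w t"
  "vol_form g s p t w v u = vol_form g s p u v w t"
  by (simp_all add: vol_form_def wedge4_expand algebra_simps)

lemma vol_form_eq_0:
  "vol_form g s p u u w t = 0" "vol_form g s p u v u t = 0" "vol_form g s p u v w u = 0"
  "vol_form g s p u v v t = 0" "vol_form g s p u v w v = 0" "vol_form g s p u v w w = 0"
  by (simp_all add: vol_form_def wedge4_expand algebra_simps)

lemma linear_vol_form:
  "linear (\<lambda>u. vol_form g s p u v w t)" "linear (\<lambda>v. vol_form g s p u v w t)"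
  "linear (\<lambda>w. vol_form g s p u v w t)" "linear (\<lambda>t. vol_form g s p u v w t)"
  by (auto intro!: linearI simp: vol_form_def wedge4_expand dx_def dz_def dxi_def algebra_simps)

lemma bilinear_wedge2:
  assumes "linear \<alpha>" "linear \<beta>"
  shows "bilinear (wedge2 \<alpha> \<beta> :: 'a::real_vector \<Rightarrow> 'a \<Rightarrow> real)"
  unfolding bilinear_def wedge2_def
  by (intro conjI allI linearI)
    (simp_all add: linear_add[OF assms(1)] linear_add[OF assms(2)] linear_cmul[OF assms(1)]
      linear_cmul[OF assms(2)] algebra_simps)

lemma bilinear_scaled:
  fixes q :: "'a::real_vector \<Rightarrow> 'a \<Rightarrow> real"
  assumes "bilinear q"
  shows "bilinear (\<lambda>u v. c * q u v)"
  unfolding bilinear_def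
  by (intro conjI allI linearI)
    (simp_all add: bilinear_ladd[OF assms] bilinear_radd[OF assms] bilinear_lmul[OF assms]
      bilinear_rmul[OF assms] algebra_simps)

lemma bilinear_diff:
  fixes q r :: "'a::real_vector \<Rightarrow> 'a \<Rightarrow> real"
  assumes "bilinear q" "bilinear r"
  shows "bilinear (\<lambda>u v. q u v - r u v)"
  unfolding bilinear_def
  by (intro conjI allI linearI)
    (simp_all add: bilinear_ladd[OF assms(1)] bilinear_radd[OF assms(1)] bilinear_lmul[OF assms(1)]
      bilinear_rmul[OF assms(1)] bilinear_ladd[OF assms(2)] bilinear_radd[OF assms(2)]
      bilinear_lmul[OF assms(2)] bilinear_rmul[OF assms(2)] algebra_simps)

text \<open>Gram matrices change by congruence with the matrix \<open>P\<close> of coordinates of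
  \<open>F\<close>, whose determinant is the coordinate volume of \<open>F\<close>.\<close>

lemma det_gram:
  fixes F :: "pt^4"
  assumes "bilinear G"
  shows "det (\<chi> i j. G (F $ i) (F $ j)) =
    (wedge4 dx dz (\<lambda>y. Re (dxi y)) (\<lambda>y. Im (dxi y)) (F $ 1) (F $ 2) (F $ 3) (F $ 4))\<^sup>2
    * det (\<chi> i j. G (coord_frame $ i) (coord_frame $ j))"
proof -
  define P :: "real^4^4" where
    "P = (\<chi> i. vector [dx (F $ i), dz (F $ i), Re (dxi (F $ i)), Im (dxi (F $ i))])"
  have F: "F $ i = (\<Sum>k\<in>UNIV. P $ i $ k *\<^sub>R coord_frame $ k)" for i
    by (simp add: P_def sum_4 coord_frame_def vector_4 dx_def dz_def dxi_def prod_eq_iff complex_eq_iff)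
  have "G (F $ i) (F $ j)
      = (\<Sum>k\<in>UNIV. \<Sum>l\<in>UNIV. P $ i $ k * P $ j $ l * G (coord_frame $ k) (coord_frame $ l))" for i j
    unfolding F[of i] F[of j] bilinear_sum[OF assms]
    by (simp add: sum.cartesian_product bilinear_lmul[OF assms] bilinear_rmul[OF assms]
        case_prod_unfold mult.left_commute mult.assoc)
  then have "(\<chi> i j. G (F $ i) (F $ j))
      = P ** (\<chi> i j. G (coord_frame $ i) (coord_frame $ j)) ** transpose P"
    by (simp add: vec_eq_iff matrix_matrix_mult_def transpose_def sum_4 algebra_simps)
  then have "det (\<chi> i j. G (F $ i) (F $ j))
      = det P * det (\<chi> i j. G (coord_frame $ i) (coord_frame $ j)) * det P"
    by (simp add: det_mul)
  moreover have "wedge4 dx dz (\<lambda>y. Re (dxi y)) (\<lambda>y. Im (dxi y)) (F $ 1) (F $ 2) (F $ 3) (F $ 4) = det P"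
    by (simp add: wedge4_expand det_4 P_def vector_4 algebra_simps)
  ultimately show ?thesis by (simp add: power2_eq_square)
qed

lemma vol_form_square:
  fixes F :: "pt^4"
  assumes "bilinear (g p)" "s p = 1 \<or> s p = - 1"
  shows "(vol_form g s p (F $ 1) (F $ 2) (F $ 3) (F $ 4))\<^sup>2 = \<bar>det (\<chi> i j. g p (F $ i) (F $ j))\<bar>"
proof -
  have "(s p)\<^sup>2 = 1" using assms(2) by auto
  then show ?thesis
    unfolding det_gram[OF assms(1), of F] vol_form_def
    by (simp add: power_mult_distrib abs_mult)
qed

section \<open>The Hodge star in a null frame\<close>

locale lax_frame_4 = lax_frame M V e h
  for M :: "pt set" and V e h
begin

abbreviation vol_frame :: "(pt \<Rightarrow> real) \<Rightarrow> pt \<Rightarrow> real" where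
  "vol_frame s p \<equiv> vol_form met s p (V False False p) (V True True p) (V True False p) (V False True p)"

lemma vol_frame_square:
  assumes "p \<in> M" "s p = 1 \<or> s p = - 1"
  shows "(vol_frame s p)\<^sup>2 = ((h p)\<^sup>2 / 4)\<^sup>2"
proof -
  let ?F = "vector [V False False p, V True True p, V True False p, V False True p] :: pt^4"
  have "(vol_frame s p)\<^sup>2 = \<bar>det (\<chi> i j. met p (?F $ i) (?F $ j))\<bar>"
    using vol_form_square[of met p s ?F] bilinear_met[OF assms(1)] assms(2) by (simp add: vector_4)
  \<comment> \<open>The order of \<open>?F\<close> puts the two null pairs into diagonal blocks,
    each of determinant minus the square of \<open>h / 2\<close>.\<close>
  also have "det (\<chi> i j. met p (?F $ i) (?F $ j)) = ((h p)\<^sup>2 / 4)\<^sup>2"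
    by (simp add: det_4 vector_4 met_def dual assms(1) power2_eq_square)
  finally show ?thesis by simp
qed

lemma raise_met:
  assumes "p \<in> M"
  shows "met p (raise met p b) w = w \<bullet> b"
proof -
  \<comment> \<open>The inverse metric in the null frame: the coefficient of \<open>V A A'\<close>
    is the value on the opposite frame vector divided by the pairing of the two. It witnesses the
    description in \<open>sharp\<close>.\<close>
  define v where "v = (\<Sum>A\<in>UNIV. \<Sum>A'\<in>UNIV.
      ((if A = A' then 2 else - 2) / h p * (V (\<not> A) (\<not> A') p \<bullet> b)) *\<^sub>R V A A' p)"
  have v: "e A A' p v = (if A = A' then 2 else - 2) / h p * (V (\<not> A) (\<not> A') p \<bullet> b)" for A A'
    unfolding v_def by (rule coframe_combination[OF assms])
  have *: "met p v w = w \<bullet> b" for w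
  proof (rule frame_eqI[OF assms, where f = "met p v" and g = "\<lambda>w. w \<bullet> b"])
    show "linear (met p v)" by (rule linear_met[OF assms])
    show "linear (\<lambda>w. w \<bullet> b)"
      by (rule bounded_linear.linear[OF bounded_linear_inner_left])
    fix A A'
    show "met p v (V A A' p) = V A A' p \<bullet> b"
      by (cases A; cases A') (simp_all add: met_def v dual assms h_nonzero)
  qed
  have "raise met p b = v"
    unfolding raise_def sharp_def
  proof (rule the_equality)
    show "x = v" if "\<forall>w. met p x w = w \<bullet> b" for x
      by (rule met_nondegenerate[OF assms]) (simp only: that * )
  qed (simp only: *, simp)
  then show ?thesis by (simp only: * )
qed

lemma raise_frame:
  assumes "p \<in> M"
  shows "raise met p b = (\<Sum>A\<in>UNIV. \<Sum>A'\<in>UNIV.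
    (V (\<not> A) (\<not> A') p \<bullet> b) *\<^sub>R ((if A = A' then 2 else - 2) / h p) *\<^sub>R V A A' p)"
proof (rule coframe_eqI[OF assms])
  fix A A'
  show "e A A' p (raise met p b) = e A A' p (\<Sum>A\<in>UNIV. \<Sum>A'\<in>UNIV.
      (V (\<not> A) (\<not> A') p \<bullet> b) *\<^sub>R ((if A = A' then 2 else - 2) / h p) *\<^sub>R V A A' p)"
    by (simp only: scaleR_scaleR coframe_combination[OF assms])
      (simp only: e_met[OF assms] raise_met[OF assms] mult.commute)
qed

text \<open>Contraction with the inverse metric, whose only frame entries join opposite
  indices.\<close>

lemma sum_raise:
  assumes "p \<in> M" "bilinear q"
  shows "(\<Sum>b\<in>Basis. q (raise met p b) b) = (\<Sum>A\<in>UNIV. \<Sum>A'\<in>UNIV.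
    (if A = A' then 2 else - 2) / h p * q (V A A' p) (V (\<not> A) (\<not> A') p))"
proof -
  interpret l: linear "\<lambda>x. q x y" for y using assms(2) unfolding bilinear_def by blast
  interpret r: linear "q x" for x using assms(2) unfolding bilinear_def by blast
  let ?c = "\<lambda>A A'. (if A = A' then 2 else - 2) / h p"
  have "(\<Sum>b\<in>Basis. q (raise met p b) b)
      = (\<Sum>b\<in>Basis. \<Sum>A\<in>UNIV. \<Sum>A'\<in>UNIV. (V (\<not> A) (\<not> A') p \<bullet> b) * (?c A A' * q (V A A' p) b))"
    unfolding raise_frame[OF assms(1)] l.sum l.scale by simp
  also have "\<dots> = (\<Sum>A\<in>UNIV. \<Sum>A'\<in>UNIV. \<Sum>b\<in>Basis. (V (\<not> A) (\<not> A') p \<bullet> b) * (?c A A' * q (V A A' p) b))"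
    by (subst sum.swap, rule sum.cong[OF refl], rule sum.swap)
  also have "\<dots> = (\<Sum>A\<in>UNIV. \<Sum>A'\<in>UNIV.
      ?c A A' * q (V A A' p) (\<Sum>b\<in>Basis. (V (\<not> A) (\<not> A') p \<bullet> b) *\<^sub>R b))"
    unfolding r.sum r.scale by (simp add: sum_distrib_left mult.left_commute)
  finally show ?thesis by (simp only: euclidean_representation)
qed

text \<open>\<open>sum_raise\<close> is used once for each slot of \<omega>. The two factors
  \<open>2 / h\<close> and the half in \<open>hodge\<close> combine to the constant in front, and
  the two signs to the conditional.\<close>

lemma hodge_sum:
  assumes "p \<in> M" "bilinear \<omega>"
  shows "hodge met s p \<omega> u v = 2 / (h p)\<^sup>2 *
    (\<Sum>A\<in>UNIV. \<Sum>A'\<in>UNIV. \<Sum>B\<in>UNIV. \<Sum>B'\<in>UNIV.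
      (if (A = A') = (B = B') then 1 else - 1) * (\<omega> (V A A' p) (V B B' p) *
      vol_form met s p (V (\<not> A) (\<not> A') p) (V (\<not> B) (\<not> B') p) u v))"
proof -
  note lin = linear_add[OF linear_vol_form(1)] linear_cmul[OF linear_vol_form(1)]
    linear_add[OF linear_vol_form(2)] linear_cmul[OF linear_vol_form(2)]
    bilinear_ladd[OF assms(2)] bilinear_lmul[OF assms(2)]
    bilinear_radd[OF assms(2)] bilinear_rmul[OF assms(2)]
  have 1: "(\<Sum>b\<in>Basis. \<omega> x (raise met p b) * vol_form met s p a b u v) =
      (\<Sum>B\<in>UNIV. \<Sum>B'\<in>UNIV. (if B = B' then 2 else - 2) / h p *
        (\<omega> x (V B B' p) * vol_form met s p a (V (\<not> B) (\<not> B') p) u v))" for x a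
    by (rule sum_raise[OF assms(1), of "\<lambda>y b. \<omega> x y * vol_form met s p a b u v"])
      (unfold bilinear_def, intro conjI allI linearI, simp_all add: lin algebra_simps)
  have "(\<Sum>a\<in>Basis. \<Sum>B\<in>UNIV. \<Sum>B'\<in>UNIV. (if B = B' then 2 else - 2) / h p *
        (\<omega> (raise met p a) (V B B' p) * vol_form met s p a (V (\<not> B) (\<not> B') p) u v)) =
      (\<Sum>A\<in>UNIV. \<Sum>A'\<in>UNIV. (if A = A' then 2 else - 2) / h p *
        (\<Sum>B\<in>UNIV. \<Sum>B'\<in>UNIV. (if B = B' then 2 else - 2) / h p * (\<omega> (V A A' p) (V B B' p) *
        vol_form met s p (V (\<not> A) (\<not> A') p) (V (\<not> B) (\<not> B') p) u v)))"
    by (rule sum_raise[OF assms(1), of "\<lambda>x a. \<Sum>B\<in>UNIV. \<Sum>B'\<in>UNIV. (if B = B' then 2 else - 2) / h p *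
        (\<omega> x (V B B' p) * vol_form met s p a (V (\<not> B) (\<not> B') p) u v)"])
      (unfold bilinear_def, intro conjI allI linearI, simp_all add: lin UNIV_bool algebra_simps)
  also have "\<dots> = (\<Sum>A\<in>UNIV. \<Sum>A'\<in>UNIV. \<Sum>B\<in>UNIV. \<Sum>B'\<in>UNIV. 4 / (h p)\<^sup>2 *
      ((if (A = A') = (B = B') then 1 else - 1) * (\<omega> (V A A' p) (V B B' p) *
        vol_form met s p (V (\<not> A) (\<not> A') p) (V (\<not> B) (\<not> B') p) u v)))"
    unfolding sum_distrib_left
    by (intro sum.cong refl) (simp add: power2_eq_square)
  finally show ?thesis unfolding hodge_def 1 by (simp only: sum_distrib_left[symmetric]) simp
qed

lemma linear_hodge:
  assumes "p \<in> M" "bilinear \<omega>"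
  shows "linear (\<lambda>u. hodge met s p \<omega> u v)" "linear (hodge met s p \<omega> u)"
  unfolding hodge_def
  by (rule linearI; simp add: linear_add[OF linear_vol_form(3)]
      linear_cmul[OF linear_vol_form(3)] linear_add[OF linear_vol_form(4)]
      linear_cmul[OF linear_vol_form(4)] distrib_left sum.distrib sum_distrib_left
      add_divide_distrib mult.left_commute)+

text \<open>The splitting of two-forms by spinor indices. Exchanging \<open>A\<close> and
  \<open>B\<close> negates the part antisymmetric in the unprimed index and fixes the symmetric
  part, so the star is \<kappa> on the former and -\<kappa> on the latter. Components with equal
  primed index see only the former.\<close>

lemma hodge_frame:
  assumes "p \<in> M" "bilinear \<omega>" "\<And>u v. \<omega> v u = - \<omega> u v" "vol_frame s p = \<kappa> * (h p)\<^sup>2 / 4"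
  shows "hodge met s p \<omega> (V A A' p) (V B B' p) =
    (if A' = B' then \<kappa> * \<omega> (V A A' p) (V B B' p) else - \<kappa> * \<omega> (V B A' p) (V A B' p))"
proof -
  let ?N = "vol_form met s p"
  define a b c d where "a = V False False p" and "b = V True True p"
    and "c = V True False p" and "d = V False True p"
  define k where "k = \<kappa> * (h p)\<^sup>2 / 4"
  note frame = a_def[symmetric] b_def[symmetric] c_def[symmetric] d_def[symmetric]
  have N: "?N a b c d = k" using assms(4) by (simp add: frame k_def)
  note perms = vol_form_permute[where g = met and s = s and p = p and u = a and v = b and w = c and t = d]
  have diag: "\<omega> x x = 0" for x using assms(3)[of x x] by simp
  have anti: "\<omega> b a = - \<omega> a b" "\<omega> c a = - \<omega> a c" "\<omega> d a = - \<omega> a d"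
    "\<omega> c b = - \<omega> b c" "\<omega> d b = - \<omega> b d" "\<omega> d c = - \<omega> c d"
    by (rule assms(3))+
  have "(\<Sum>C\<in>UNIV. \<Sum>C'\<in>UNIV. \<Sum>D\<in>UNIV. \<Sum>D'\<in>UNIV.
      (if (C = C') = (D = D') then 1 else - 1) * (\<omega> (V C C' p) (V D D' p) *
      vol_form met s p (V (\<not> C) (\<not> C') p) (V (\<not> D) (\<not> D') p) (V A A' p) (V B B' p)))
    = (if A' = B' then 2 * (\<omega> (V A A' p) (V B B' p) * k) else - 2 * (\<omega> (V B A' p) (V A B' p) * k))"
    by (cases A; cases A'; cases B; cases B')
      (simp_all add: UNIV_bool frame N perms vol_form_eq_0 diag anti)
  then show ?thesis
    unfolding hodge_sum[OF assms(1,2)] k_def using h_nonzero[OF assms(1)] by simp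
qed

lemma frame_eqI2:
  assumes "p \<in> M" "\<And>v. linear (\<lambda>u. f u v)" "\<And>u. linear (f u)" "\<And>v. linear (\<lambda>u. g u v)" "\<And>u. linear (g u)"
    "\<And>A A' B B'. f (V A A' p) (V B B' p) = g (V A A' p) (V B B' p)"
  shows "f u v = g u v"
proof (rule frame_eqI[OF assms(1,2,4), of v v u])
  fix A A'
  show "f (V A A' p) v = g (V A A' p) v"
    by (rule frame_eqI[OF assms(1,3,5)]) (rule assms(6))
qed

text \<open>A component with equal primed indices is multiplied by \<kappa>, here
  \<open>4 * vol_frame s p / (h p)\<^sup>2\<close>; if it is nonzero, anti-self-duality forces
  -1.\<close>

lemma vol_frame_if_anti_self_dual:
  assumes "p \<in> M" "s p = 1 \<or> s p = - 1" "bilinear \<omega>" "\<And>u v. \<omega> v u = - \<omega> u v"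
    and "\<omega> (V False False p) (V True False p) \<noteq> 0" "anti_self_dual met s p \<omega>"
  shows "vol_frame s p = - (h p)\<^sup>2 / 4"
proof -
  have "vol_frame s p = (4 * vol_frame s p / (h p)\<^sup>2) * (h p)\<^sup>2 / 4"
    using h_nonzero[OF assms(1)] by simp
  note hodge_frame[OF assms(1,3,4) this, of False False True False]
  moreover have "hodge met s p \<omega> (V False False p) (V True False p)
      = - \<omega> (V False False p) (V True False p)"
    using assms(6) unfolding anti_self_dual_def by blast
  ultimately have "(4 * vol_frame s p / (h p)\<^sup>2 + 1) * \<omega> (V False False p) (V True False p) = 0"
    by (simp add: algebra_simps)
  with assms(5) have "4 * vol_frame s p / (h p)\<^sup>2 = - 1"
    unfolding mult_eq_0_iff by linarith
  then show ?thesis using h_nonzero[OF assms(1)] by (simp add: field_simps)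
qed

text \<open>For \<kappa> = -1 the star negates components with equal primed indices in any case and
  exchanges \<open>A\<close> and \<open>B\<close> in the mixed ones, so only these carry a
  condition.\<close>

lemma anti_self_dualI:
  assumes "p \<in> M" "vol_frame s p = - (h p)\<^sup>2 / 4" "bilinear \<omega>" "\<And>u v. \<omega> v u = - \<omega> u v"
    and "\<And>A B. \<omega> (V A False p) (V B True p) = - \<omega> (V B False p) (V A True p)"
  shows "anti_self_dual met s p \<omega>"
  unfolding anti_self_dual_def
proof (intro allI)
  fix u v
  have v: "vol_frame s p = (- 1) * (h p)\<^sup>2 / 4" using assms(2) by simp
  have l: "linear (\<lambda>u. - \<omega> u v)" "linear (\<lambda>v. - \<omega> u v)" for u v
    using assms(3) linear_compose_neg[of "\<lambda>u. \<omega> u v"] linear_compose_neg[of "\<omega> u"]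
    unfolding bilinear_def by blast+
  show "hodge met s p \<omega> u v = - \<omega> u v"
  proof (rule frame_eqI2[OF assms(1) linear_hodge[OF assms(1,3)] l])
    fix A A' B B'
    show "hodge met s p \<omega> (V A A' p) (V B B' p) = - \<omega> (V A A' p) (V B B' p)"
    proof (cases "A' = B'")
      case False
      have "\<omega> (V B A' p) (V A B' p) = - \<omega> (V A A' p) (V B B' p)"
      proof (cases A')
        case True
        then show ?thesis
          using False assms(4)[of "V A False p" "V B True p"] assms(4)[of "V B False p" "V A True p"]
            assms(5)[of A B] by (cases B') auto
      next
        case F: False
        then show ?thesis using False assms(5)[of B A] by (cases B') auto
      qed
      then show ?thesis
        unfolding hodge_frame[OF assms(1,3,4) v] if_not_P[OF False] by simp
    qed (simp add: hodge_frame[OF assms(1,3,4) v])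
  qed
qed

text \<open>The other eigenspace: negated components must vanish, mixed ones must be symmetric in
  \<open>A\<close> and \<open>B\<close>, which is a single equation.\<close>

lemma self_dualI:
  assumes "p \<in> M" "vol_frame s p = - (h p)\<^sup>2 / 4" "bilinear \<omega>" "\<And>u v. \<omega> v u = - \<omega> u v"
    and "\<And>A B A'. \<omega> (V A A' p) (V B A' p) = 0"
    and "\<omega> (V False False p) (V True True p) = \<omega> (V True False p) (V False True p)"
  shows "self_dual met s p \<omega>"
  unfolding self_dual_def
proof (intro allI)
  fix u v
  have v: "vol_frame s p = (- 1) * (h p)\<^sup>2 / 4" using assms(2) by simp
  have l: "linear (\<lambda>u. \<omega> u v)" "linear (\<omega> u)" for u v
    using assms(3) unfolding bilinear_def by blast+
  have sym: "\<omega> (V A False p) (V B True p) = \<omega> (V B False p) (V A True p)" for A B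
    using assms(6) by (cases A; cases B) auto
  show "hodge met s p \<omega> u v = \<omega> u v"
  proof (rule frame_eqI2[OF assms(1) linear_hodge[OF assms(1,3)] l])
    fix A A' B B'
    show "hodge met s p \<omega> (V A A' p) (V B B' p) = \<omega> (V A A' p) (V B B' p)"
    proof (cases "A' = B'")
      case False
      have "\<omega> (V B A' p) (V A B' p) = \<omega> (V A A' p) (V B B' p)"
      proof (cases A')
        case True
        then show ?thesis
          using False assms(4)[of "V A False p" "V B True p"] assms(4)[of "V B False p" "V A True p"]
            sym[of A B] by (cases B') auto
      next
        case F: False
        then show ?thesis using False sym[of B A] by (cases B') auto
      qed
      then show ?thesis
        unfolding hodge_frame[OF assms(1,3,4) v] if_not_P[OF False] by simp
    qed (simp add: hodge_frame[OF assms(1,3,4) v] assms(5))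
  qed
qed

lemma weyl_self_dual:
  assumes "p \<in> M" "vol_frame s p = - (h p)\<^sup>2 / 4"
  shows "self_dual met s p (\<lambda>u v. weyl met p u v w t)"
proof (rule self_dualI[OF assms])
  have anti: "weyl met p v u w t = - weyl met p u v w t" for u v
  proof -
    have "riemann met p v u w = - riemann met p u v w" by (simp add: riemann_def)
    then show ?thesis by (simp add: weyl_met assms(1) linear_neg[OF linear_met_left[OF assms(1)]])
  qed
  have l: "linear (\<lambda>u. weyl met p u v w t)" for v
    using linear_compose[OF linear_riemann linear_met_left, OF assms(1) assms(1)]
    by (simp add: weyl_met[OF assms(1)] o_def)
  have "linear (\<lambda>v. weyl met p u v w t)" for u
    using linear_compose_neg[OF l[of u]] by (simp only: anti[of _ u] minus_minus)
  with l show "bilinear (\<lambda>u v. weyl met p u v w t)" unfolding bilinear_def by blast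
  show "weyl met p v u w t = - weyl met p u v w t" for u v by (rule anti)
qed (use weyl_frame[OF assms(1)] in auto)

lemma pseudo_metric_22: "pseudo_metric_22_on M met"
  unfolding pseudo_metric_22_on_def
proof (intro conjI allI ballI)
  show "smooth_on M (\<lambda>p. met p u v)" for u v by (rule smooth_met)
  fix p assume p: "p \<in> M"
  show "bilinear (met p)" by (rule bilinear_met[OF p])
  show "met p u v = met p v u" for u v by (rule met_sym)
  \<comment> \<open>Each null pair spans a hyperbolic plane. The factor \<open>1 / h\<close>
    normalises the squares to 1 and -1 for either sign of \<open>h\<close>; the signs of the second
    pair are reversed because its pairing is negative multiple of \<open>h\<close>.\<close>
  let ?b = "vector [V False False p + (1 / h p) *\<^sub>R V True True p,
      V True False p - (1 / h p) *\<^sub>R V False True p,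
      V False False p - (1 / h p) *\<^sub>R V True True p,
      V True False p + (1 / h p) *\<^sub>R V False True p] :: pt^4"
  have "\<forall>i j. met p (?b $ i) (?b $ j) = (if i \<noteq> j then 0 else if i = 1 \<or> i = 2 then 1 else - 1)"
    using h_nonzero[OF p]
    by (simp add: forall_4 vector_4 met_def e_simps dual p)
  then show "\<exists>b :: pt^4. \<forall>i j. met p (b $ i) (b $ j) =
      (if i \<noteq> j then 0 else if i = 1 \<or> i = 2 then 1 else - 1)" by blast
qed

end

subsection \<open>The frame of a solution of the nonlinear Schroedinger equation\<close>

lemma cmod_squared: "complex_of_real ((cmod z)\<^sup>2) = z * cnj z"
  by (rule complex_norm_square)

lemma cmod_squared_Re_Im: "(cmod z)\<^sup>2 = Re z * Re z + Im z * Im z"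
  by (subst cmod_power2) (simp only: power2_eq_square)

lemma nu_frame:
  "nu (x, z, \<xi>) (W \<phi> (x, z, \<xi>)) (Wt (x, z, \<xi>)) (Z \<phi> (x, z, \<xi>)) (Zt (x, z, \<xi>))
    = of_real (2 * Re (cnj \<xi> * \<phi> (x, z)) / (1 + (cmod \<xi>)\<^sup>2))"
proof -
  define n where "n = 1 + (cmod \<xi>)\<^sup>2"
  have n: "complex_of_real n = 1 + \<xi> * cnj \<xi>" "n \<noteq> 0"
    using complex_norm_square[of \<xi>] by (simp_all add: n_def add_nonneg_eq_0_iff)
  define r where "r = 2 * Re (cnj \<xi> * \<phi> (x, z))"
  have "wedge4 (\<lambda>y. complex_of_real (dx y)) (\<lambda>y. of_real (dz y)) dxi (\<lambda>y. cnj (dxi y))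
      (W \<phi> (x, z, \<xi>)) (Wt (x, z, \<xi>)) (Z \<phi> (x, z, \<xi>)) (Zt (x, z, \<xi>))
      = - \<i> * of_real n * of_real r"
    unfolding n(1) r_def
    by (simp add: wedge4_expand dx_def dz_def dxi_def complex_eq_iff power2_eq_square algebra_simps)
  moreover have "1 + dxi (x, z, \<xi>) * cnj (dxi (x, z, \<xi>)) = of_real n"
    by (simp add: n(1) dxi_def)
  ultimately show ?thesis
    unfolding nu_def n_def[symmetric] r_def[symmetric] using n(2)
    by (simp only:) (simp add: field_simps power2_eq_square)
qed

lemma f2_eq: "f2 \<phi> p = 2 * Re (cnj (dxi p) * \<phi> (dx p, dz p)) / (1 + (cmod (dxi p))\<^sup>2)"
  by (cases p rule: prod_cases3) (simp only: f2_def nu_frame dx_def dz_def dxi_def fst_conv snd_conv Re_complex_of_real)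

lemma bounded_linear_coordinates: "bounded_linear dx" "bounded_linear dz" "bounded_linear dxi"
  unfolding dx_def dz_def dxi_def
  by (intro bounded_linear_intros)+

text \<open>Cramer's rule over the reals for the vectors \<open>w\<close> and
  \<open>\<i> * \<xi>\<close> of the complex plane, whose determinant is
  \<open>Re (cnj \<xi> * w)\<close>.\<close>

lemma real_combination:
  assumes "Re (cnj \<xi> * w) \<noteq> 0"
  shows "of_real (Re (cnj \<xi> * c) / Re (cnj \<xi> * w)) * w
    + of_real (Im (cnj w * c) / Re (cnj \<xi> * w)) * (\<i> * \<xi>) = c"
proof -
  define a b d where "a = Re (cnj \<xi> * c)" and "b = Im (cnj w * c)" and "d = Re (cnj \<xi> * w)"
  have "a * Re w - b * Im \<xi> = d * Re c" "a * Im w + b * Re \<xi> = d * Im c"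
    by (simp_all add: a_def b_def d_def algebra_simps)
  moreover have "d \<noteq> 0" using assms by (simp add: d_def)
  ultimately show ?thesis
    unfolding a_def[symmetric] b_def[symmetric] d_def[symmetric]
    by (simp add: complex_eq_iff field_simps)
qed

definition nls_frame :: "(real \<times> real \<Rightarrow> complex) \<Rightarrow> bool \<Rightarrow> bool \<Rightarrow> pt \<Rightarrow> pt" where
  "nls_frame \<phi> A A' = (if A then (if A' then Wt else Z \<phi>) else (if A' then Zt else W \<phi>))"

definition nls_coframe :: "(real \<times> real \<Rightarrow> complex) \<Rightarrow> bool \<Rightarrow> bool \<Rightarrow> pt \<Rightarrow> pt \<Rightarrow> real" where
  "nls_coframe \<phi> A A' p =
    (if A then (if A' then e_Wt \<phi> p else e_Z \<phi> p) else (if A' then e_Zt \<phi> p else e_W \<phi> p))"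

context
  fixes \<phi> :: "real \<times> real \<Rightarrow> complex"
begin

definition wxi :: "pt \<Rightarrow> complex" where "wxi p = dxi (W \<phi> p)"
definition zxi :: "pt \<Rightarrow> complex" where "zxi p = dxi (Z \<phi> p)"

text \<open>Once the \<open>dz\<close> part is removed with \<open>Z\<close>, only \<open>W\<close>
  and \<open>Zt\<close> have fibre components; \<open>cW\<close> and \<open>cZt\<close> are their
  Cramer coefficients.\<close>

definition cW :: "pt \<Rightarrow> pt \<Rightarrow> real" where
  "cW p v = Re (cnj (dxi p) * (dxi v - of_real (dz v) * zxi p)) / Re (cnj (dxi p) * wxi p)"

definition cZt :: "pt \<Rightarrow> pt \<Rightarrow> real" where
  "cZt p v = Im (cnj (wxi p) * (dxi v - of_real (dz v) * zxi p)) / Re (cnj (dxi p) * wxi p)"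

lemma frame_eq:
  "W \<phi> p = (1, 0, wxi p)" "Wt p = (1, 0, 0)" "Z \<phi> p = (0, 1, zxi p)" "Zt p = (0, 0, \<i> * dxi p)"
  by (cases p rule: prod_cases3; simp add: wxi_def zxi_def dxi_def)+

lemma frame_fun:
  "W \<phi> = (\<lambda>p. (1, 0, wxi p))" "Wt = (\<lambda>p. (1, 0, 0))" "Z \<phi> = (\<lambda>p. (0, 1, zxi p))"
  "Zt = (\<lambda>p. (0, 0, \<i> * dxi p))"
  by (rule ext, rule frame_eq)+

lemma wxi_eq: "wxi p = cnj (\<phi> (dx p, dz p)) * (dxi p * dxi p) + \<phi> (dx p, dz p)"
  by (cases p rule: prod_cases3) (simp add: wxi_def dx_def dz_def dxi_def power2_eq_square)

lemma zxi_eq: "zxi p = \<i> * (- cnj (D_x \<phi> (dx p, dz p)) * (dxi p * dxi p)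
    + 2 * (\<phi> (dx p, dz p) * cnj (\<phi> (dx p, dz p))) * dxi p + D_x \<phi> (dx p, dz p))"
  by (cases p rule: prod_cases3)
    (simp add: zxi_def dx_def dz_def dxi_def power2_eq_square[of "_::complex"] cmod_squared del: of_real_power)

text \<open>The Cramer determinant is a positive multiple of \<open>f2\<close>, so the frame is a
  basis exactly where \<open>f2\<close> does not vanish.\<close>

lemma Re_wxi: "Re (cnj (dxi p) * wxi p)
    = (1 + (cmod (dxi p))\<^sup>2) * Re (cnj (dxi p) * \<phi> (dx p, dz p))"
  unfolding wxi_eq cmod_power2 by (simp add: algebra_simps power2_eq_square)

lemma Re_wxi_nonzero: "f2 \<phi> p \<noteq> 0 \<Longrightarrow> Re (cnj (dxi p) * wxi p) \<noteq> 0"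
  unfolding Re_wxi f2_eq by (auto simp: add_nonneg_eq_0_iff)

lemma frame_decomposition:
  assumes "f2 \<phi> p \<noteq> 0"
  shows "v = cW p v *\<^sub>R W \<phi> p + (dx v - cW p v) *\<^sub>R Wt p + dz v *\<^sub>R Z \<phi> p + cZt p v *\<^sub>R Zt p"
proof -
  let ?c = "dxi v - of_real (dz v) * zxi p"
  have "of_real (cW p v) * wxi p + of_real (cZt p v) * (\<i> * dxi p) = ?c"
    unfolding cW_def cZt_def by (rule real_combination[OF Re_wxi_nonzero[OF assms]])
  then show ?thesis
    unfolding frame_eq by (simp add: prod_eq_iff dx_def dz_def dxi_def scaleR_conv_of_real algebra_simps)
qed

lemma linear_coframe: "linear (cW p)" "linear (\<lambda>v. dx v - cW p v)" "linear dz" "linear (cZt p)"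
  by (rule linearI; simp add: cW_def cZt_def dx_def dz_def dxi_def scaleR_conv_of_real algebra_simps
      add_divide_distrib diff_divide_distrib)+

lemma coordinates_frame:
  "dx (W \<phi> p) = 1" "dz (W \<phi> p) = 0" "dxi (W \<phi> p) = wxi p"
  "dx (Wt p) = 1" "dz (Wt p) = 0" "dxi (Wt p) = 0"
  "dx (Z \<phi> p) = 0" "dz (Z \<phi> p) = 1" "dxi (Z \<phi> p) = zxi p"
  "dx (Zt p) = 0" "dz (Zt p) = 0" "dxi (Zt p) = \<i> * dxi p"
  by (simp_all add: frame_eq dx_def dz_def dxi_def)

lemma cW_cZt_frame:
  assumes "f2 \<phi> p \<noteq> 0"
  shows "cW p (W \<phi> p) = 1" "cW p (Wt p) = 0" "cW p (Z \<phi> p) = 0" "cW p (Zt p) = 0"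
    "cZt p (W \<phi> p) = 0" "cZt p (Wt p) = 0" "cZt p (Z \<phi> p) = 0" "cZt p (Zt p) = 1"
  using Re_wxi_nonzero[OF assms] by (simp_all add: cW_def cZt_def coordinates_frame algebra_simps)

lemma coframe_eqI:
  assumes "f2 \<phi> p \<noteq> 0" "linear \<beta>" "\<forall>j. \<beta> (frame \<phi> p $ j) = (if j = i then 1 else 0)"
  shows "coframe \<phi> p i = \<beta>"
  unfolding coframe_def
proof (rule the_equality)
  fix \<alpha> :: "pt \<Rightarrow> real"
  assume a: "linear \<alpha> \<and> (\<forall>j. \<alpha> (frame \<phi> p $ j) = (if j = i then 1 else 0))"
  then have "\<alpha> (frame \<phi> p $ j) = \<beta> (frame \<phi> p $ j)" for j using assms(3) by simp
  then have eq: "\<alpha> (W \<phi> p) = \<beta> (W \<phi> p)" "\<alpha> (Wt p) = \<beta> (Wt p)"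
    "\<alpha> (Z \<phi> p) = \<beta> (Z \<phi> p)" "\<alpha> (Zt p) = \<beta> (Zt p)"
    by (metis frame_def vector_4)+
  interpret a: linear \<alpha> using a by blast
  interpret b: linear \<beta> by (rule assms(2))
  show "\<alpha> = \<beta>"
  proof
    fix v
    show "\<alpha> v = \<beta> v"
      by (subst (1 2) frame_decomposition[OF assms(1), of v])
        (simp only: a.add a.scale b.add b.scale eq)
  qed
qed (use assms in blast)

lemma coframe_eq:
  assumes "f2 \<phi> p \<noteq> 0"
  shows "e_W \<phi> p = cW p" "e_Wt \<phi> p = (\<lambda>v. dx v - cW p v)" "e_Z \<phi> p = dz" "e_Zt \<phi> p = cZt p"
  unfolding e_W_def e_Wt_def e_Z_def e_Zt_def
  by (rule coframe_eqI[OF assms], rule linear_coframe,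
      simp add: forall_4 frame_def vector_4 cW_cZt_frame[OF assms] coordinates_frame)+

end

section \<open>Smoothness of the frame built from a solution\<close>

locale nls_solution =
  fixes U :: "(real \<times> real) set" and \<phi> :: "real \<times> real \<Rightarrow> complex" and M :: "pt set"
  assumes open_U: "open U"
    and smooth_phi: "smooth_on U \<phi>"
    and nls: "NLS_on U \<phi>"
    and M_def: "M = {(x, z, \<xi>). (x, z) \<in> U \<and> f2 \<phi> (x, z, \<xi>) \<noteq> 0}"
begin

abbreviation base :: "pt \<Rightarrow> real \<times> real" where "base p \<equiv> (dx p, dz p)"

lemma mem_M: "p \<in> M \<longleftrightarrow> base p \<in> U \<and> f2 \<phi> p \<noteq> 0"
  by (cases p rule: prod_cases3) (simp add: M_def dx_def dz_def)

lemma bounded_linear_base: "bounded_linear base"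
  by (intro bounded_linear_Pair bounded_linear_coordinates)

lemma open_domain: "open (base -` U)"
  by (rule open_vimage[OF open_U linear_continuous_on[OF bounded_linear_base]])

lemma smooth_base: "smooth_on U f \<Longrightarrow> smooth_on (base -` U) (\<lambda>p. f (base p))"
  by (rule smooth_on_comp_linear[OF bounded_linear_base open_domain open_U]) auto

lemma smooth_coordinates [smooth_intros]:
  "smooth_on S dx" "smooth_on S dz" "smooth_on S dxi"
  by (intro smooth_on_bounded_linear bounded_linear_coordinates)+

lemma smooth_D_x: "smooth_on U (D_x \<phi>)" "smooth_on U (D_x (D_x \<phi>))"
  unfolding D_x_def by (intro smooth_intros smooth_phi)+

lemma smooth_f2: "smooth_on (base -` U) (f2 \<phi>)"
proof -
  have "smooth_on (base -` U) (\<lambda>p. 2 * Re (cnj (dxi p) * \<phi> (base p)) / (1 + ((Re (dxi p))\<^sup>2 + (Im (dxi p))\<^sup>2)))"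
    by (intro smooth_intros open_domain smooth_base smooth_phi)
      (metis add_pos_nonneg less_irrefl sum_power2_ge_zero zero_less_one)
  moreover have "f2 \<phi> = (\<lambda>p. 2 * Re (cnj (dxi p) * \<phi> (base p)) / (1 + ((Re (dxi p))\<^sup>2 + (Im (dxi p))\<^sup>2)))"
    unfolding cmod_power2[symmetric] by (rule ext) (rule f2_eq)
  ultimately show ?thesis by simp
qed

lemma open_M: "open M"
proof -
  have "M = f2 \<phi> -` (- {0}) \<inter> base -` U" using mem_M by auto
  then show ?thesis
    using continuous_on_open_vimage[OF open_domain, of "f2 \<phi>"]
      smooth_on_imp_continuous_on[OF smooth_f2] by auto
qed

lemma M_subset: "M \<subseteq> base -` U"
  using mem_M by auto

lemma smooth_wxi: "smooth_on (base -` U) (wxi \<phi>)"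
proof -
  have "smooth_on (base -` U) (\<lambda>p. cnj (\<phi> (base p)) * (dxi p * dxi p) + \<phi> (base p))"
    by (intro smooth_intros open_domain smooth_base smooth_phi)
  then show ?thesis by (simp only: wxi_eq[symmetric])
qed

lemma smooth_zxi: "smooth_on (base -` U) (zxi \<phi>)"
proof -
  have "smooth_on (base -` U) (\<lambda>p. \<i> * (- cnj (D_x \<phi> (base p)) * (dxi p * dxi p)
      + 2 * (\<phi> (base p) * cnj (\<phi> (base p))) * dxi p + D_x \<phi> (base p)))"
    by (intro smooth_intros open_domain smooth_base smooth_phi smooth_D_x)
  then show ?thesis by (simp only: zxi_eq[symmetric])
qed

lemma smooth_frame: "smooth_on (base -` U) (nls_frame \<phi> A A')"
proof -
  have "smooth_on (base -` U) (\<lambda>p. (1, 0, wxi \<phi> p) :: pt)"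
    "smooth_on (base -` U) (\<lambda>p. (1, 0, 0) :: pt)"
    "smooth_on (base -` U) (\<lambda>p. (0, 1, zxi \<phi> p) :: pt)"
    "smooth_on (base -` U) (\<lambda>p. (0, 0, \<i> * dxi p) :: pt)"
    by (intro smooth_intros open_domain smooth_wxi smooth_zxi)+
  then show ?thesis
    by (simp add: nls_frame_def frame_fun)
qed

lemma smooth_coframe: "smooth_on M (\<lambda>p. nls_coframe \<phi> A A' p v)"
proof -
  have w: "smooth_on M (wxi \<phi>)" "smooth_on M (zxi \<phi>)"
    using smooth_wxi smooth_zxi smooth_on_subset[OF _ M_subset] by blast+
  have D: "Re (cnj (dxi p) * wxi \<phi> p) \<noteq> 0" if "p \<in> M" for p
    using that mem_M Re_wxi_nonzero by blast
  have s: "smooth_on M (\<lambda>p. cW \<phi> p v)" "smooth_on M (\<lambda>p. cZt \<phi> p v)"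
    unfolding cW_def cZt_def by (intro smooth_intros open_M w D; assumption)+
  have "smooth_on M (\<lambda>p. e_W \<phi> p v)" "smooth_on M (\<lambda>p. e_Wt \<phi> p v)"
    "smooth_on M (\<lambda>p. e_Z \<phi> p v)" "smooth_on M (\<lambda>p. e_Zt \<phi> p v)"
    using s smooth_on_diff[OF open_M smooth_on_const s(1), of "dx v"] smooth_on_const[of M "dz v"]
    by (auto intro: smooth_on_cong[OF open_M, rotated] simp: coframe_eq mem_M)
  then show ?thesis unfolding nls_coframe_def by (cases A; cases A') auto
qed

text \<open>The equation solved for the \<open>z\<close>-derivative; this is the only place where it
  enters.\<close>

lemma D_z_phi:
  assumes "q \<in> U"
  shows "D_z \<phi> q = \<i> * (D_x (D_x \<phi>) q + 2 * (\<phi> q * cnj (\<phi> q)) * \<phi> q)"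
proof -
  have "\<i> * D_z \<phi> q = - D_x (D_x \<phi>) q - 2 * (\<phi> q * cnj (\<phi> q)) * \<phi> q"
    using nls assms unfolding NLS_on_def cmod_squared by blast
  then have "- \<i> * (\<i> * D_z \<phi> q) = - \<i> * (- D_x (D_x \<phi>) q - 2 * (\<phi> q * cnj (\<phi> q)) * \<phi> q)"
    by simp
  then show ?thesis by (simp add: algebra_simps)
qed

section \<open>Derivatives and brackets of the frame fields\<close>

lemma has_derivative_base:
  assumes "smooth_on U f" "base p \<in> U"
  shows "((\<lambda>p. f (base p)) has_derivative
    (\<lambda>v. of_real (dx v) * D_x f (base p) + of_real (dz v) * D_z f (base p))) (at p)"
proof -
  have f: "f differentiable (at (base p))"
    by (rule smooth_on_imp_differentiable[OF assms])
  have "dderiv f (a, b) (base p) = a *\<^sub>R D_x f (base p) + b *\<^sub>R D_z f (base p)" for a b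
    using linear_add[OF linear_dderiv[OF f], of "a *\<^sub>R (1, 0)" "b *\<^sub>R (0, 1)"]
      linear_cmul[OF linear_dderiv[OF f], of a "(1, 0)"] linear_cmul[OF linear_dderiv[OF f], of b "(0, 1)"]
    by (simp add: D_x_def D_z_def)
  moreover have "((\<lambda>p. f (base p)) has_derivative (\<lambda>v. dderiv f (base v) (base p))) (at p)"
    by (rule has_derivative_compose[OF bounded_linear_imp_has_derivative[OF bounded_linear_base]
          has_derivative_dderiv[OF f]])
  ultimately show ?thesis by (simp add: scaleR_conv_of_real)
qed

lemmas coordinate_derivatives =
  bounded_linear_imp_has_derivative[OF bounded_linear_coordinates(1)]
  bounded_linear_imp_has_derivative[OF bounded_linear_coordinates(2)]
  bounded_linear_imp_has_derivative[OF bounded_linear_coordinates(3)]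

lemmas derivative_rules = has_derivative_mult has_derivative_add has_derivative_diff
  has_derivative_minus has_derivative_const has_derivative_Pair coordinate_derivatives
  bounded_linear.has_derivative[OF bounded_linear_cnj]
  bounded_linear.has_derivative[OF bounded_linear_Re]
  bounded_linear.has_derivative[OF bounded_linear_Im]

lemma dderiv_W:
  assumes "base p \<in> U"
  defines "\<psi>' \<equiv> \<lambda>v. of_real (dx v) * D_x \<phi> (base p) + of_real (dz v) * D_z \<phi> (base p)"
  shows "dderiv (W \<phi>) v p
    = (0, 0, cnj (\<psi>' v) * (dxi p)\<^sup>2 + 2 * cnj (\<phi> (base p)) * dxi p * dxi v + \<psi>' v)"
proof -
  have "(W \<phi> has_derivative (\<lambda>v. (0, 0, cnj (\<phi> (base p)) * (dxi p * dxi v + dxi v * dxi p)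
      + cnj (\<psi>' v) * (dxi p * dxi p) + \<psi>' v))) (at p)"
    unfolding frame_fun wxi_eq \<psi>'_def
    by (rule derivative_rules has_derivative_base[OF smooth_phi assms(1)])+
  from dderiv_eqI[OF this] show ?thesis by (simp add: power2_eq_square algebra_simps)
qed

text \<open>The mixed derivative \<open>D_z (D_x \<phi>)\<close> comes with the factor
  \<open>dz v\<close>. It drops out of all brackets, because \<open>W\<close>, \<open>Wt\<close> and
  \<open>Zt\<close> have no \<open>z\<close>-component.\<close>

lemma dderiv_Z:
  assumes "base p \<in> U"
  defines "\<psi> \<equiv> \<phi> (base p)" and "\<eta> \<equiv> D_x \<phi> (base p)"
    and "\<psi>' \<equiv> \<lambda>v. of_real (dx v) * D_x \<phi> (base p) + of_real (dz v) * D_z \<phi> (base p)"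
    and "\<eta>' \<equiv> \<lambda>v. of_real (dx v) * D_x (D_x \<phi>) (base p) + of_real (dz v) * D_z (D_x \<phi>) (base p)"
  shows "dderiv (Z \<phi>) v p
    = (0, 0, \<i> * (- cnj (\<eta>' v) * (dxi p)\<^sup>2 - 2 * cnj \<eta> * dxi p * dxi v
        + 2 * (\<psi> * cnj (\<psi>' v) + \<psi>' v * cnj \<psi>) * dxi p + 2 * \<psi> * cnj \<psi> * dxi v + \<eta>' v))"
proof -
  have "(Z \<phi> has_derivative (\<lambda>v. (0, 0, \<i> * ((- cnj \<eta>) * (dxi p * dxi v + dxi v * dxi p)
      + (- cnj (\<eta>' v)) * (dxi p * dxi p)
      + (2 * (\<psi> * cnj \<psi>) * dxi v + (2 * (\<psi> * cnj (\<psi>' v) + \<psi>' v * cnj \<psi>) + 0 * (\<psi> * cnj \<psi>)) * dxi p)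
      + \<eta>' v) + 0 * (- cnj \<eta> * (dxi p * dxi p) + 2 * (\<psi> * cnj \<psi>) * dxi p + \<eta>)))) (at p)"
    unfolding frame_fun zxi_eq \<psi>_def \<eta>_def \<psi>'_def \<eta>'_def
    by (rule derivative_rules has_derivative_base[OF smooth_phi assms(1)]
        has_derivative_base[OF smooth_D_x(1) assms(1)])+
  from dderiv_eqI[OF this] show ?thesis by (simp add: power2_eq_square algebra_simps)
qed

lemma dderiv_Wt: "dderiv Wt v p = 0"
  unfolding frame_fun by (rule dderiv_eqI[OF has_derivative_const])

lemma dderiv_Zt: "dderiv Zt v p = (0, 0, \<i> * dxi v)"
proof -
  have "(Zt has_derivative (\<lambda>v. (0, 0, \<i> * dxi v + 0 * dxi p))) (at p)"
    unfolding frame_fun by (rule derivative_rules)+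
  from dderiv_eqI[OF this] show ?thesis by simp
qed

text \<open>The first bracket vanishes by the nonlinear Schroedinger equation.\<close>

lemma brackets:
  assumes "base p \<in> U"
  defines "\<psi> \<equiv> \<phi> (base p)" and "\<eta> \<equiv> D_x \<phi> (base p)" and "\<eta>' \<equiv> D_x (D_x \<phi>) (base p)"
  shows "bracket (W \<phi>) (Z \<phi>) p = 0"
    and "bracket Wt Zt p = 0"
    and "bracket (W \<phi>) Wt p = (0, 0, - (cnj \<eta> * (dxi p)\<^sup>2 + \<eta>))"
    and "bracket (Z \<phi>) Zt p = (0, 0, - (cnj \<eta> * (dxi p)\<^sup>2 + \<eta>))"
    and "bracket (W \<phi>) Zt p = (0, 0, \<i> * (\<psi> - cnj \<psi> * (dxi p)\<^sup>2))"
    and "bracket (Z \<phi>) Wt p = (0, 0, - \<i> * (- cnj \<eta>' * (dxi p)\<^sup>2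
      + 2 * (\<psi> * cnj \<eta> + \<eta> * cnj \<psi>) * dxi p + \<eta>'))"
  unfolding bracket_def dderiv_W[OF assms(1)] dderiv_Z[OF assms(1)] dderiv_Wt dderiv_Zt
    coordinates_frame wxi_eq zxi_eq D_z_phi[OF assms(1)] \<psi>_def \<eta>_def \<eta>'_def
  by (simp_all add: zero_prod_def power2_eq_square algebra_simps)

lemma dderiv_f2:
  assumes "base p \<in> U"
  defines "n \<equiv> 1 + (cmod (dxi p))\<^sup>2" and "\<psi> \<equiv> \<phi> (base p)"
    and "\<psi>' \<equiv> \<lambda>v. of_real (dx v) * D_x \<phi> (base p) + of_real (dz v) * D_z \<phi> (base p)"
  shows "dderiv (f2 \<phi>) v p = 2 * (Re (cnj (dxi v) * \<psi> + cnj (dxi p) * \<psi>' v) * n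
    - Re (cnj (dxi p) * \<psi>) * (2 * Re (cnj (dxi p) * dxi v))) / (n * n)"
proof -
  have f2_fun: "f2 \<phi> = (\<lambda>p. 2 * Re (cnj (dxi p) * \<phi> (base p))
      / (1 + (Re (dxi p) * Re (dxi p) + Im (dxi p) * Im (dxi p))))"
    by (rule ext) (simp only: f2_eq cmod_squared_Re_Im)
  have n: "n = 1 + (Re (dxi p) * Re (dxi p) + Im (dxi p) * Im (dxi p))"
    by (simp only: n_def cmod_squared_Re_Im)
  have n0: "1 + (Re (dxi p) * Re (dxi p) + Im (dxi p) * Im (dxi p)) \<noteq> 0"
    by (metis add_pos_nonneg less_irrefl sum_squares_ge_zero zero_less_one)
  have "(f2 \<phi> has_derivative (\<lambda>v.
      ((2 * Re (cnj (dxi p) * \<psi>' v + cnj (dxi v) * \<psi>) + 0 * Re (cnj (dxi p) * \<psi>)) * n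
      - 2 * Re (cnj (dxi p) * \<psi>) * (0 + ((Re (dxi p) * Re (dxi v) + Re (dxi v) * Re (dxi p))
        + (Im (dxi p) * Im (dxi v) + Im (dxi v) * Im (dxi p))))) / (n * n))) (at p)"
    unfolding f2_fun n \<psi>_def \<psi>'_def
    by (rule has_derivative_divide', (rule derivative_rules has_derivative_base[OF smooth_phi assms(1)])+,
        rule n0)
  from dderiv_eqI[OF this] show ?thesis by (simp add: algebra_simps)
qed

text \<open>All brackets of frame fields are vertical, so these values suffice for their
  divergences.\<close>

lemma coframe_vertical:
  assumes "p \<in> M"
  defines "d \<equiv> (1 + (cmod (dxi p))\<^sup>2) * Re (cnj (dxi p) * \<phi> (base p))"
  shows "e_W \<phi> p (0, 0, c) = Re (cnj (dxi p) * c) / d" "e_Wt \<phi> p (0, 0, c) = - (Re (cnj (dxi p) * c) / d)"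
    "e_Z \<phi> p (0, 0, c) = 0" "e_Zt \<phi> p (0, 0, c) = Im (cnj (wxi \<phi> p) * c) / d"
  using assms(1) unfolding mem_M d_def Re_wxi[symmetric]
  by (simp_all add: coframe_eq cW_def cZt_def dx_def dz_def dxi_def)

text \<open>The fibre parts of the frame fields are zero or of the form
  \<open>c + \<i> * b * \<xi> + cnj c * \<xi>\<^sup>2\<close> with real \<open>b\<close>,
  infinitesimal rotations of the sphere. These preserve its area form, which is the fibre factor of
  \<open>nu\<close>; here this is verified by computation.\<close>

lemma frame_divergence_free:
  assumes "p \<in> M"
  shows "dderiv (f2 \<phi>) (nls_frame \<phi> A A' p) p = f2 \<phi> p * (\<Sum>B\<in>UNIV. \<Sum>B'\<in>UNIV.
    nls_coframe \<phi> B B' p (bracket (nls_frame \<phi> A A') (nls_frame \<phi> B B') p))"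
proof -
  have b: "base p \<in> U" using assms mem_M by blast
  define n where "n = 1 + (cmod (dxi p))\<^sup>2"
  define r where "r = Re (cnj (dxi p) * \<phi> (base p))"
  have n0: "n \<noteq> 0" by (simp add: n_def add_nonneg_eq_0_iff)
  have f2: "f2 \<phi> p = 2 * r / n" by (simp only: f2_eq n_def r_def)
  then have r0: "r \<noteq> 0" using assms mem_M by auto
  have n_eq: "n = 1 + (Re (dxi p) * Re (dxi p) + Im (dxi p) * Im (dxi p))"
    by (simp only: n_def cmod_squared_Re_Im)
  note e = coframe_vertical[OF assms, folded n_def r_def]
  note D = dderiv_f2[OF b, folded n_def r_def]
  \<comment> \<open>The logarithmic derivative of \<open>2 * r / n\<close> has the same denominator
    \<open>n * r\<close> as the coframe, so only numerators are left to compare.\<close>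
  have aux: "2 * (r' * n - r * n') / (n * n) = 2 * r / n * (X / (n * r))" if "r' * n - r * n' = X" for r' n' X
    using n0 r0 that by (simp add: field_simps)
  have self: "bracket X X p = 0" for X :: "pt \<Rightarrow> pt" by (simp add: bracket_def)
  have zero: "e_W \<phi> p 0 = 0" "e_Wt \<phi> p 0 = 0" "e_Z \<phi> p 0 = 0" "e_Zt \<phi> p 0 = 0"
    using e[of 0] by (simp_all add: zero_prod_def)
  have neg: "- (0, 0, c) = ((0, 0, - c) :: pt)" for c by simp
  note br = brackets[OF b] self zero neg
    bracket_antisym[of Zt "W \<phi>"] bracket_antisym[of Zt "Z \<phi>"] bracket_antisym[of "Z \<phi>" "W \<phi>"]
    bracket_antisym[of Wt "W \<phi>"] bracket_antisym[of Wt "Z \<phi>"] bracket_antisym[of Zt Wt]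
  note expand = nls_coframe_def nls_frame_def UNIV_bool
  define \<xi> where "\<xi> = dxi p"
  define \<psi> where "\<psi> = \<phi> (base p)"
  define \<eta> where "\<eta> = D_x \<phi> (base p)"
  define \<eta>' where "\<eta>' = D_x (D_x \<phi>) (base p)"
  note fold = \<xi>_def[symmetric] \<psi>_def[symmetric] \<eta>_def[symmetric] \<eta>'_def[symmetric]
  let ?P = "- (cnj \<eta> * \<xi>\<^sup>2 + \<eta>)" and ?Q = "\<i> * (\<psi> - cnj \<psi> * \<xi>\<^sup>2)"
    and ?S = "- \<i> * (- cnj \<eta>' * \<xi>\<^sup>2 + 2 * (\<psi> * cnj \<eta> + \<eta> * cnj \<psi>) * \<xi> + \<eta>')"
  let ?sum = "\<lambda>X. \<Sum>B\<in>UNIV. \<Sum>B'\<in>UNIV. nls_coframe \<phi> B B' p (bracket X (nls_frame \<phi> B B') p)"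
  have sums:
    "?sum (W \<phi>) = (Im (cnj (wxi \<phi> p) * ?Q) - Re (cnj \<xi> * ?P)) / (n * r)"
    "?sum Zt = (- Re (cnj \<xi> * ?Q)) / (n * r)"
    "?sum (Z \<phi>) = (Im (cnj (wxi \<phi> p) * ?P) - Re (cnj \<xi> * ?S)) / (n * r)"
    "?sum Wt = (- Re (cnj \<xi> * ?P)) / (n * r)"
    by (simp only: expand sum.insert sum.empty finite.intros empty_iff insert_iff simp_thms if_True if_False
        br e fold, simp add: algebra_simps add_divide_distrib diff_divide_distrib)+
  have w: "wxi \<phi> p = cnj \<psi> * (\<xi> * \<xi>) + \<psi>" by (simp only: wxi_eq fold)
  have z: "zxi \<phi> p = \<i> * (- cnj \<eta> * (\<xi> * \<xi>) + 2 * (\<psi> * cnj \<psi>) * \<xi> + \<eta>)"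
    by (simp only: zxi_eq fold)
  have D_z: "D_z \<phi> (base p) = \<i> * (\<eta>' + 2 * (\<psi> * cnj \<psi>) * \<psi>)"
    by (simp only: D_z_phi[OF b] fold)
  have "dderiv (f2 \<phi>) (W \<phi> p) p = f2 \<phi> p * ?sum (W \<phi>)"
    unfolding D sums f2 coordinates_frame fold D_z w
    by (rule aux) (simp add: n_eq r_def fold algebra_simps power2_eq_square)
  moreover have "dderiv (f2 \<phi>) (Zt p) p = f2 \<phi> p * ?sum Zt"
    unfolding D sums f2 coordinates_frame fold D_z w
    by (rule aux) (simp add: n_eq r_def fold algebra_simps power2_eq_square)
  moreover have "dderiv (f2 \<phi>) (Z \<phi> p) p = f2 \<phi> p * ?sum (Z \<phi>)"
    unfolding D sums f2 coordinates_frame fold D_z w z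
    by (rule aux) (simp add: n_eq r_def fold algebra_simps power2_eq_square)
  moreover have "dderiv (f2 \<phi>) (Wt p) p = f2 \<phi> p * ?sum Wt"
    unfolding D sums f2 coordinates_frame fold D_z w
    by (rule aux) (simp add: n_eq r_def fold algebra_simps power2_eq_square)
  ultimately show ?thesis
    unfolding nls_frame_def[of \<phi> A A'] by simp
qed

lemma coframe_dual:
  assumes "p \<in> M"
  shows "nls_coframe \<phi> A A' p (nls_frame \<phi> B B' p) = (if A = B \<and> A' = B' then 1 else 0)"
proof -
  have f: "f2 \<phi> p \<noteq> 0" using assms mem_M by blast
  show ?thesis
    by (cases A; cases A'; cases B; cases B')
      (simp_all add: nls_coframe_def nls_frame_def coframe_eq[OF f] cW_cZt_frame[OF f] coordinates_frame)
qed

lemma lax_frame_nls: "lax_frame_4 M (nls_frame \<phi>) (nls_coframe \<phi>) (f2 \<phi>)"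
proof (rule lax_frame_4.intro, rule lax_frame.intro)
  show "open M" by (rule open_M)
  show "smooth_on M (nls_frame \<phi> A A')" for A A'
    by (rule smooth_on_subset[OF smooth_frame M_subset])
  show "smooth_on M (\<lambda>p. nls_coframe \<phi> A A' p v)" for A A' v
    by (rule smooth_coframe)
  show "smooth_on M (f2 \<phi>)"
    by (rule smooth_on_subset[OF smooth_f2 M_subset])
  fix p assume p: "p \<in> M"
  show f: "f2 \<phi> p \<noteq> 0" using p mem_M by blast
  show "linear (nls_coframe \<phi> A A' p)" for A A'
    using linear_coframe by (simp add: nls_coframe_def coframe_eq[OF f])
  show "nls_coframe \<phi> A A' p (nls_frame \<phi> B B' p) = (if A = B \<and> A' = B' then 1 else 0)" for A A' B B'
    by (rule coframe_dual[OF p])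
  show "(\<Sum>A\<in>UNIV. \<Sum>A'\<in>UNIV. nls_coframe \<phi> A A' p v *\<^sub>R nls_frame \<phi> A A' p) = v" for v
    using frame_decomposition[OF f, of v]
    by (simp add: UNIV_bool nls_coframe_def nls_frame_def coframe_eq[OF f] add_ac)
  have b: "base p \<in> U" using p mem_M by blast
  have "bracket X X p = 0" for X :: "pt \<Rightarrow> pt" by (simp add: bracket_def)
  then show "bracket (nls_frame \<phi> A A') (nls_frame \<phi> B A') p = 0" for A B A'
    using brackets(1,2)[OF b] bracket_antisym[of "Z \<phi>" "W \<phi>" p] bracket_antisym[of Wt Zt p]
    by (simp add: nls_frame_def)
  show "bracket (nls_frame \<phi> False False) (nls_frame \<phi> True True) p
      = bracket (nls_frame \<phi> True False) (nls_frame \<phi> False True) p"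
    by (simp add: nls_frame_def brackets[OF b])
  show "dderiv (f2 \<phi>) (nls_frame \<phi> A A' p) p = f2 \<phi> p * (\<Sum>B\<in>UNIV. \<Sum>B'\<in>UNIV.
      nls_coframe \<phi> B B' p (bracket (nls_frame \<phi> A A') (nls_frame \<phi> B B') p))" for A A'
    by (rule frame_divergence_free[OF p])
qed

section \<open>Half-flatness and the adapted orientation\<close>

sublocale lax_frame_4 M "nls_frame \<phi>" "nls_coframe \<phi>" "f2 \<phi>"
  by (rule lax_frame_nls)

lemma met_eq: "met = nls_metric \<phi>"
  by (intro ext) (simp add: met_def nls_metric_def sym_prod_def nls_coframe_def field_simps)

lemma linear_e_coframe:
  assumes "p \<in> M"
  shows "linear (e_W \<phi> p)" "linear (e_Wt \<phi> p)" "linear (e_Z \<phi> p)" "linear (e_Zt \<phi> p)"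
  using linear_coframe assms mem_M by (simp_all add: coframe_eq)

text \<open>Of the three prescribed forms, the one built from \<open>e_W\<close> and
  \<open>e_Z\<close> determines the orientation: its value on \<open>W\<close>, \<open>Z\<close> is
  \<open>f2\<close>, which is nonzero.\<close>

lemma adapted_vol_frame:
  assumes "adapted_orientation_on \<phi> M s" "p \<in> M"
  shows "vol_frame s p = - (f2 \<phi> p)\<^sup>2 / 4"
proof (rule vol_frame_if_anti_self_dual[OF assms(2)])
  let ?\<omega> = "\<lambda>u v. f2 \<phi> p * wedge2 (e_W \<phi> p) (e_Z \<phi> p) u v"
  show "s p = 1 \<or> s p = - 1" "anti_self_dual met s p ?\<omega>"
    using assms unfolding met_eq adapted_orientation_on_def orientation_on_def by blast+
  show "?\<omega> v u = - ?\<omega> u v" for u v by (simp add: wedge2_def algebra_simps)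
  show "bilinear ?\<omega>"
    by (intro bilinear_scaled bilinear_wedge2 linear_e_coframe assms(2))
  show "?\<omega> (nls_frame \<phi> False False p) (nls_frame \<phi> True False p) \<noteq> 0"
    using h_nonzero[OF assms(2)] dual[OF assms(2), of False False] dual[OF assms(2), of True False]
    by (simp add: wedge2_def nls_coframe_def)
qed

lemma half_flat:
  assumes "adapted_orientation_on \<phi> M s"
  shows "half_flat_on M (nls_metric \<phi>) s"
  unfolding half_flat_on_def met_eq[symmetric]
  using ricci_flat weyl_self_dual adapted_vol_frame[OF assms] by blast

text \<open>\<open>vol_frame_square\<close> gives the value up to sign. The coordinate volume of the
  frame is \<open>n * r\<close>, which has the sign of \<open>f2\<close>, so the factor
  \<open>- sgn (f2 \<phi> p)\<close> makes the result negative.\<close>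

lemma vol_frame_sgn:
  assumes "p \<in> M"
  shows "vol_frame (\<lambda>p. - sgn (f2 \<phi> p)) p = - (f2 \<phi> p)\<^sup>2 / 4"
proof -
  let ?s = "\<lambda>p. - sgn (f2 \<phi> p)"
  define n where "n = 1 + (cmod (dxi p))\<^sup>2"
  define r where "r = Re (cnj (dxi p) * \<phi> (base p))"
  have n: "n > 0" by (simp add: n_def add_pos_nonneg)
  have f2: "f2 \<phi> p = 2 * r / n" by (simp only: f2_eq n_def r_def)
  have "wedge4 dx dz (\<lambda>y. Re (dxi y)) (\<lambda>y. Im (dxi y)) (W \<phi> p) (Wt p) (Z \<phi> p) (Zt p)
      = Re (cnj (dxi p) * wxi \<phi> p)"
    by (simp add: wedge4_expand coordinates_frame algebra_simps)
  also have "\<dots> = n * r" by (simp only: Re_wxi n_def r_def)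
  finally have "vol_frame ?s p = - (n * \<bar>r\<bar>) * sqrt \<bar>det (\<chi> i j. met p (coord_frame $ i) (coord_frame $ j))\<bar>"
    unfolding vol_form_def f2 nls_frame_def using n by (simp add: abs_sgn sgn_mult sgn_divide)
  then have "vol_frame ?s p \<le> 0" using n by (simp add: mult_nonneg_nonneg)
  moreover have "vol_frame ?s p = (f2 \<phi> p)\<^sup>2 / 4 \<or> vol_frame ?s p = - ((f2 \<phi> p)\<^sup>2 / 4)"
    using h_nonzero[OF assms] vol_frame_square[OF assms, of ?s]
    unfolding power2_eq_iff by (simp add: sgn_if)
  moreover have "(f2 \<phi> p)\<^sup>2 > 0" using h_nonzero[OF assms] by simp
  ultimately show ?thesis by auto
qed

text \<open>Guarantees that the statement about all adapted orientations is not vacuous. The witness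
  is continuous because \<open>f2\<close> is continuous and has no zero on \<open>M\<close>.\<close>

lemma adapted_orientation: "adapted_orientation_on \<phi> M (\<lambda>p. - sgn (f2 \<phi> p))"
proof -
  let ?s = "\<lambda>p. - sgn (f2 \<phi> p)"
  have "orientation_on M ?s"
    unfolding orientation_on_def
  proof (intro conjI ballI)
    show "continuous_on M ?s"
      using h_nonzero
      by (intro continuous_on_minus continuous_on_sgn smooth_on_imp_continuous_on[OF smooth_h]) blast
  qed (use h_nonzero in \<open>auto simp: sgn_if\<close>)
  moreover have "anti_self_dual met ?s p (\<lambda>u v. f2 \<phi> p * wedge2 (e_W \<phi> p) (e_Z \<phi> p) u v)"
    "anti_self_dual met ?s p
      (\<lambda>u v. f2 \<phi> p * (wedge2 (e_W \<phi> p) (e_Wt \<phi> p) u v - wedge2 (e_Z \<phi> p) (e_Zt \<phi> p) u v))"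
    "anti_self_dual met ?s p (\<lambda>u v. f2 \<phi> p * wedge2 (e_Wt \<phi> p) (e_Zt \<phi> p) u v)"
    if p: "p \<in> M" for p
  proof -
    have d: "e_W \<phi> p (nls_frame \<phi> B B' p) = (if \<not> B \<and> \<not> B' then 1 else 0)"
      "e_Wt \<phi> p (nls_frame \<phi> B B' p) = (if B \<and> B' then 1 else 0)"
      "e_Z \<phi> p (nls_frame \<phi> B B' p) = (if B \<and> \<not> B' then 1 else 0)"
      "e_Zt \<phi> p (nls_frame \<phi> B B' p) = (if \<not> B \<and> B' then 1 else 0)" for B B'
      using dual[OF p, of False False B B'] dual[OF p, of True True B B']
        dual[OF p, of True False B B'] dual[OF p, of False True B B']
      by (simp_all add: nls_coframe_def)
    note l = linear_e_coframe[OF p]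
    show "anti_self_dual met ?s p (\<lambda>u v. f2 \<phi> p * wedge2 (e_W \<phi> p) (e_Z \<phi> p) u v)"
      by (rule anti_self_dualI[OF p vol_frame_sgn[OF p]])
        (intro bilinear_scaled bilinear_wedge2 l, simp_all add: wedge2_def d algebra_simps)
    show "anti_self_dual met ?s p (\<lambda>u v. f2 \<phi> p * wedge2 (e_Wt \<phi> p) (e_Zt \<phi> p) u v)"
      by (rule anti_self_dualI[OF p vol_frame_sgn[OF p]])
        (intro bilinear_scaled bilinear_wedge2 l, simp_all add: wedge2_def d algebra_simps)
    show "anti_self_dual met ?s p
      (\<lambda>u v. f2 \<phi> p * (wedge2 (e_W \<phi> p) (e_Wt \<phi> p) u v - wedge2 (e_Z \<phi> p) (e_Zt \<phi> p) u v))"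
      by (rule anti_self_dualI[OF p vol_frame_sgn[OF p]])
        (intro bilinear_scaled bilinear_diff bilinear_wedge2 l, simp_all add: wedge2_def d algebra_simps)
  qed
  ultimately show ?thesis
    unfolding adapted_orientation_on_def met_eq by blast
qed

end

theorem mainTheorem2:
  fixes U :: "(real \<times> real) set"
    and \<phi> :: "real \<times> real \<Rightarrow> complex"
    and M :: "pt set"
  assumes "open U"
    and "smooth_on U \<phi>"
    and "NLS_on U \<phi>"
    and M_def: "M = {(x, z, \<xi>). (x, z) \<in> U \<and> f2 \<phi> (x, z, \<xi>) \<noteq> 0}"
  shows "(\<forall>x z \<xi>. (x, z) \<in> U \<longrightarrow>
            nu (x, z, \<xi>) (W \<phi> (x, z, \<xi>)) (Wt (x, z, \<xi>)) (Z \<phi> (x, z, \<xi>)) (Zt (x, z, \<xi>))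
              = of_real (2 * Re (cnj \<xi> * \<phi> (x, z)) / (1 + (cmod \<xi>)\<^sup>2)))
       \<and> open M
       \<and> pseudo_metric_22_on M (nls_metric \<phi>)
       \<and> (\<exists>s. adapted_orientation_on \<phi> M s)
       \<and> (\<forall>s. adapted_orientation_on \<phi> M s \<longrightarrow> half_flat_on M (nls_metric \<phi>) s)"
proof -
  interpret nls_solution U \<phi> M
    by (rule nls_solution.intro[OF assms])
  show ?thesis
    using nu_frame open_M pseudo_metric_22[unfolded met_eq] adapted_orientation half_flat by blast
qed

end
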